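(* Let $s>0$ and $v\in\mathbb{N}$. Let $\mathcal{F}=\{\phi_k : k\in\mathbb{Z}\}\cup\{\psi_{j,k} : j\in\mathbb{N},\,k\in\mathbb{Z}\}\subset\mathcal{C}^s(\mathbb{R})$ be a system of functions satisfying the assumptions (I)-(V) listed in the context (with this $s$ and with $v$ vanishing moments). Then, for every $r\in(0,\min(s,v))$, $$B^{r}_{\infty,\infty}(\mathbb{R})=\Big\{\sum_{k\in\mathbb{Z}}a_k\phi_k+\sum_{j\in\mathbb{N}}\sum_{k\in\mathbb{Z}}b_{j,k}\psi_{j,k}\;:\;\sup_{k\in\mathbb{Z}}|a_k|<\infty,\ \ \sup_{j\in\mathbb{N}}2^{j(r+\frac12)}\sup_{k\in\mathbb{Z}}|b_{j,k}|<\infty\Big\},$$ where $\{a_k\}_{k\in\mathbb{Z}}$ and $\{b_{j,k}\}_{j\in\mathbb{N},k\in\mathbb{Z}}$ range over real sequences.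
   Context: $\mathbb{N}=\{1,2,\dots\}$, $\mathbb{N}_0=\mathbb{N}\cup\{0\}$; functions are real-valued on $\mathbb{R}$ and $\langle f,g\rangle=\int_{\mathbb{R}}f(x)g(x)\,dx$. Function spaces. For $s\in\mathbb{N}_0$, $\mathcal{C}^s(\mathbb{R})$ is the space of $s$ times continuously differentiable functions. For $s=\ell+\alpha$, $\ell\in\mathbb{N}_0$, $\alpha\in(0,1)$, $\mathcal{C}^s(\mathbb{R})=\{f\in\mathcal{C}^\ell(\mathbb{R}):\sup_{x\in\mathbb{R},h\neq0}|f^{(\ell)}(x+h)-f^{(\ell)}(x)|/|h|^\alpha<\infty\}$. The norm is $\|f\|_{\mathcal{C}^s}=\sum_{i=0}^{s}\|f^{(i)}\|_{L^\infty}$ for $s\in\mathbb{N}_0$, and $\|f\|_{\mathcal{C}^s}=\sum_{i=0}^{\ell}\|f^{(i)}\|_{L^\infty}+\sup_{x,h\ne0}|f^{(\ell)}(x+h)-f^{(\ell)}(x)|/|h|^\alpha$ for $s=\ell+\alpha$. The Zygmund class $\Lambda(\mathbb{R})$ consists of $f:\mathbb{R}\to\mathbb{R}$ with $\sup_{x\in\mathbb{R},h\ne0}|f(x+h)-2f(x)+f(x-h)|/|h|<\infty$. For $r>0$, $$B^r_{\infty,\infty}(\mathbb{R})=\begin{cases}\mathcal{C}^r(\mathbb{R})\cap L^\infty(\mathbb{R}), & r\notin\mathbb{N},\\ \{f\in\mathcal{C}^{r-1}(\mathbb{R})\cap L^\infty(\mathbb{R}): f^{(r-1)}\in\Lambda(\mathbb{R})\},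 & r\in\mathbb{N}.\end{cases}$$ Assumptions on $\mathcal{F}$ (for given $s>0$, $v\in\mathbb{N}$): (I) $\mathcal{F}$ is a Parseval (normalized) tight frame for $L^2(\mathbb{R})$: $f=\sum_{k}\langle f,\phi_k\rangle\phi_k+\sum_{j\in\mathbb{N}}\sum_{k}\langle f,\psi_{j,k}\rangle\psi_{j,k}$ for all $f\in L^2(\mathbb{R})$. (II) There is $C_{supp}>0$ with $\sup_{k}|\mathrm{supp}(\phi_k)|\le C_{supp}$ and $\sup_k|\mathrm{supp}(\psi_{j,k})|\le C_{supp}2^{-j}$ for all $j\in\mathbb{N}$, where $|\mathrm{supp}(\cdot)|$ is the length of the smallest closed interval containing the support. (III) There is $C_\Gamma>0$ such that for every bounded interval $K\subset\mathbb{R}$ (single points allowed) the sets $\Gamma_0(K)=\{k\in\mathbb{Z}:\mathrm{supp}(\phi_k)\cap K\neq\emptyset\}$ and $\Gamma_j(K)=\{k\in\mathbb{Z}:\mathrm{supp}(\psi_{j,k})\cap K\ne\emptyset\}$, $j\in\mathbb{N}$, satisfy $|\Gamma_j(K)|\le C_\Gamma(2^j|K|+1)$ for all $j\ge0$. (IV) ($v$ vanishing moments) $\int_{\mathbb{R}}x^n\psi_{j,k}(x)\,dx=0$ for $n\in\{0,\dots,v-1\}$, $j\in\mathbb{N}$, $k\in\mathbb{Z}$, and there are points $\{x_{j,k}:j\in\mathbb{N},k\in\mathbb{Z}\}\subset\mathbb{R}$ such that for every $0\le r\le v$ there is $C_{vm,r}>0$ with $\sup_{k}\int_{\mathbb{R}}|x|^r|\psi_{j,k}(x+x_{j,k})|\,dx\le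 C_{vm,r}2^{-j(r+\frac12)}$ for all $j\in\mathbb{N}$. (V) $\mathcal{F}\subset\mathcal{C}^s(\mathbb{R})$ and for every $0\le r\le s$ there is $C_{sm,r}>0$ with $\sup_k\|\phi_k\|_{\mathcal{C}^r}\le C_{sm,r}$ and $\sup_k\|\psi_{j,k}\|_{\mathcal{C}^r}\le C_{sm,r}2^{j(r+\frac12)}$ for all $j\in\mathbb{N}$. Convention: the series in the claim are understood as convergent in $L^2_{loc}(\mathbb{R})$; functions equal almost everywhere are identified (continuous representatives are taken). *)

theory Defs
  imports "HOL-Analysis.Analysis" "HOL-Probability.Essential_Supremum"
begin

section \<open>Function spaces on the real line\<close>

text \<open>Norms and seminorms take values in \<^typ>\<open>ennreal\<close>, so that they are meaningful (possibly
  infinite) for every function.  The \<open>i\<close>-th derivative of \<open>f\<close> is \<open>(deriv ^^ i) f\<close>.\<close>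

definition Linf_norm :: "(real \<Rightarrow> real) \<Rightarrow> ennreal" where
  "Linf_norm f = esssup lborel (\<lambda>x. ennreal \<bar>f x\<bar>)"

definition Linf :: "(real \<Rightarrow> real) set" where
  "Linf = {f \<in> borel_measurable lborel. Linf_norm f < \<infinity>}"

definition C_nat :: "nat \<Rightarrow> (real \<Rightarrow> real) set" where
  "C_nat n = {f. (\<forall>i<n. \<forall>x. (deriv ^^ i) f differentiable (at x)) \<and>
                 continuous_on UNIV ((deriv ^^ n) f)}"

definition holder_seminorm :: "real \<Rightarrow> (real \<Rightarrow> real) \<Rightarrow> ennreal" where
  "holder_seminorm \<alpha> f =
     (SUP (x, h) \<in> UNIV \<times> (- {0}). ennreal (\<bar>f (x + h) - f x\<bar> / \<bar>h\<bar> powr \<alpha>))"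

definition C_space :: "real \<Rightarrow> (real \<Rightarrow> real) set" where
  "C_space s =
     (if s \<in> \<nat> then C_nat (nat \<lfloor>s\<rfloor>)
      else {f \<in> C_nat (nat \<lfloor>s\<rfloor>). holder_seminorm (frac s) ((deriv ^^ nat \<lfloor>s\<rfloor>) f) < \<infinity>})"

definition C_norm :: "real \<Rightarrow> (real \<Rightarrow> real) \<Rightarrow> ennreal" where
  "C_norm s f =
     (\<Sum>i\<le>nat \<lfloor>s\<rfloor>. Linf_norm ((deriv ^^ i) f)) +
     (if s \<in> \<nat> then 0 else holder_seminorm (frac s) ((deriv ^^ nat \<lfloor>s\<rfloor>) f))"

definition zygmund_class :: "(real \<Rightarrow> real) set" where
  "zygmund_class =
     {f. (SUP (x, h) \<in> UNIV \<times> (- {0}). ennreal (\<bar>f (x + h) - 2 * f x + f (x - h)\<bar> / \<bar>h\<bar>)) < \<infinity>}"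

text \<open>Only meant for \<open>r > 0\<close>, so \<open>r \<in> \<nat>\<close> means that \<open>r\<close> is a positive integer.\<close>

definition besov :: "real \<Rightarrow> (real \<Rightarrow> real) set" where
  "besov r =
     (if r \<in> \<nat>
      then {f \<in> C_space (r - 1) \<inter> Linf. (deriv ^^ (nat \<lfloor>r\<rfloor> - 1)) f \<in> zygmund_class}
      else C_space r \<inter> Linf)"

section \<open>Square-integrable functions and unordered series\<close>

definition L2_on :: "real set \<Rightarrow> (real \<Rightarrow> real) set" where
  "L2_on A = {f \<in> borel_measurable lborel. set_integrable lborel A (\<lambda>x. (f x)\<^sup>2)}"

definition L2_inner :: "(real \<Rightarrow> real) \<Rightarrow> (real \<Rightarrow> real) \<Rightarrow> real" where
  "L2_inner f g = (LINT x|lborel. f x * g x)"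

text \<open>Unconditional convergence of \<open>\<Sum>i\<in>I. u i\<close> to \<open>f\<close> with respect to the \<open>L\<^sup>2(A)\<close> norm: the net
  of finite partial sums converges, as in \<^const>\<open>HAS_SUM\<close>.\<close>

definition L2_has_sum_on ::
    "real set \<Rightarrow> ('i \<Rightarrow> real \<Rightarrow> real) \<Rightarrow> 'i set \<Rightarrow> (real \<Rightarrow> real) \<Rightarrow> bool" where
  "L2_has_sum_on A u I f \<longleftrightarrow>
     f \<in> L2_on A \<and> (\<forall>i\<in>I. u i \<in> L2_on A) \<and>
     ((\<lambda>S. \<integral>\<^sup>+x\<in>A. ennreal (((\<Sum>i\<in>S. u i x) - f x)\<^sup>2) \<partial>lborel) \<longlongrightarrow> 0)
       (finite_subsets_at_top I)"

definition L2loc_has_sum ::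
    "('i \<Rightarrow> real \<Rightarrow> real) \<Rightarrow> 'i set \<Rightarrow> (real \<Rightarrow> real) \<Rightarrow> bool" where
  "L2loc_has_sum u I f \<longleftrightarrow> (\<forall>K. compact K \<longrightarrow> L2_has_sum_on K u I f)"

definition ae_class :: "(real \<Rightarrow> real) \<Rightarrow> (real \<Rightarrow> real) set" where
  "ae_class f = {g \<in> borel_measurable lborel. AE x in lborel. g x = f x}"

section \<open>Wavelet systems\<close>

text \<open>A system consists of \<open>\<phi> k\<close> (\<open>k\<close> an integer) and \<open>\<psi> j k\<close> (\<open>j \<ge> 1\<close>, \<open>k\<close> an integer); the
  values of \<open>\<psi> 0\<close> are irrelevant.  It is one family over a disjoint union of index sets.\<close>

definition wavelet_index :: "(int + nat \<times> int) set" where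
  "wavelet_index = UNIV <+> ({1..} \<times> UNIV)"

definition wavelet_family :: "(int \<Rightarrow> 'a) \<Rightarrow> (nat \<Rightarrow> int \<Rightarrow> 'a) \<Rightarrow> int + nat \<times> int \<Rightarrow> 'a" where
  "wavelet_family p q = case_sum p (\<lambda>(j, k). q j k)"

definition wavelet_series_sum ::
    "(int \<Rightarrow> real \<Rightarrow> real) \<Rightarrow> (nat \<Rightarrow> int \<Rightarrow> real \<Rightarrow> real) \<Rightarrow>
     (int \<Rightarrow> real) \<Rightarrow> (nat \<Rightarrow> int \<Rightarrow> real) \<Rightarrow> (real \<Rightarrow> real) \<Rightarrow> bool" where
  "wavelet_series_sum \<phi> \<psi> a b f \<longleftrightarrow>
     L2loc_has_sum (\<lambda>i x. wavelet_family a b i * wavelet_family \<phi> \<psi> i x) wavelet_index f"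

definition admissible_coeffs :: "real \<Rightarrow> (int \<Rightarrow> real) \<Rightarrow> (nat \<Rightarrow> int \<Rightarrow> real) \<Rightarrow> bool" where
  "admissible_coeffs r a b \<longleftrightarrow>
     (SUP k. ennreal \<bar>a k\<bar>) < \<infinity> \<and>
     (SUP j\<in>{1..}. ennreal (2 powr (real j * (r + 1/2))) * (SUP k. ennreal \<bar>b j k\<bar>)) < \<infinity>"

definition parseval_frame :: "('i \<Rightarrow> real \<Rightarrow> real) \<Rightarrow> 'i set \<Rightarrow> bool" where
  "parseval_frame e I \<longleftrightarrow>
     (\<forall>i\<in>I. e i \<in> L2_on UNIV) \<and>
     (\<forall>f\<in>L2_on UNIV. L2_has_sum_on UNIV (\<lambda>i x. L2_inner f (e i) * e i x) I f)"

definition supp :: "(real \<Rightarrow> real) \<Rightarrow> real set" where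
  "supp f = closure {x. f x \<noteq> 0}"

text \<open>Length of the smallest closed interval containing the support (infinite if there is no
  bounded one).\<close>

definition supp_length :: "(real \<Rightarrow> real) \<Rightarrow> ennreal" where
  "supp_length f = (INF (c, d) \<in> {(c, d). c \<le> d \<and> supp f \<subseteq> {c..d}}. ennreal (d - c))"

definition compactly_supported_system ::
    "(int \<Rightarrow> real \<Rightarrow> real) \<Rightarrow> (nat \<Rightarrow> int \<Rightarrow> real \<Rightarrow> real) \<Rightarrow> bool" where
  "compactly_supported_system \<phi> \<psi> \<longleftrightarrow>
     (\<exists>C>0. (SUP k. supp_length (\<phi> k)) \<le> ennreal C \<and>
        (\<forall>j\<ge>1. (SUP k. supp_length (\<psi> j k)) \<le> ennreal (C * 2 powr (- real j))))"

definition \<Gamma>set ::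
    "(int \<Rightarrow> real \<Rightarrow> real) \<Rightarrow> (nat \<Rightarrow> int \<Rightarrow> real \<Rightarrow> real) \<Rightarrow> nat \<Rightarrow> real set \<Rightarrow> int set" where
  "\<Gamma>set \<phi> \<psi> j K = {k. supp (if j = 0 then \<phi> k else \<psi> j k) \<inter> K \<noteq> {}}"

definition locally_finite_system ::
    "(int \<Rightarrow> real \<Rightarrow> real) \<Rightarrow> (nat \<Rightarrow> int \<Rightarrow> real \<Rightarrow> real) \<Rightarrow> bool" where
  "locally_finite_system \<phi> \<psi> \<longleftrightarrow>
     (\<exists>C>0. \<forall>K j. is_interval K \<and> bounded K \<longrightarrow>
        finite (\<Gamma>set \<phi> \<psi> j K) \<and>
        real (card (\<Gamma>set \<phi> \<psi> j K)) \<le> C * (2 ^ j * measure lborel K + 1))"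

text \<open>The convention \<open>0 powr 0 = 0\<close> only affects the integrand below at a single point.\<close>

definition vanishing_moments :: "nat \<Rightarrow> (nat \<Rightarrow> int \<Rightarrow> real \<Rightarrow> real) \<Rightarrow> bool" where
  "vanishing_moments v \<psi> \<longleftrightarrow>
     (\<forall>n<v. \<forall>j\<ge>1. \<forall>k. has_bochner_integral lborel (\<lambda>x. x ^ n * \<psi> j k x) 0) \<and>
     (\<exists>X :: nat \<Rightarrow> int \<Rightarrow> real. \<forall>r\<in>{0..real v}. \<exists>C>0. \<forall>j\<ge>1.
        (SUP k. \<integral>\<^sup>+x. ennreal (\<bar>x\<bar> powr r * \<bar>\<psi> j k (x + X j k)\<bar>) \<partial>lborel)
          \<le> ennreal (C * 2 powr (- (real j * (r + 1/2)))))"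

definition smooth_system ::
    "real \<Rightarrow> (int \<Rightarrow> real \<Rightarrow> real) \<Rightarrow> (nat \<Rightarrow> int \<Rightarrow> real \<Rightarrow> real) \<Rightarrow> bool" where
  "smooth_system s \<phi> \<psi> \<longleftrightarrow>
     (\<forall>k. \<phi> k \<in> C_space s) \<and> (\<forall>j\<ge>1. \<forall>k. \<psi> j k \<in> C_space s) \<and>
     (\<forall>r\<in>{0..s}. \<exists>C>0. (SUP k. C_norm r (\<phi> k)) \<le> ennreal C \<and>
        (\<forall>j\<ge>1. (SUP k. C_norm r (\<psi> j k)) \<le> ennreal (C * 2 powr (real j * (r + 1/2)))))"

end

theory Submission
  imports Defs
begin

text \<open>
  Membership of \<open>f\<close> in the Besov space of order \<open>r\<close> is equivalent to a decay of its wavelet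
  coefficients, and the two directions are independent of each other.

  \<^bold>\<open>Analysis.\<close>  On every interval of length \<open>d\<close>, a Besov function of order \<open>r\<close> differs from some
  polynomial of degree at most \<open>\<lfloor>r\<rfloor>\<close> by at most a multiple of \<open>d\<^sup>r\<close>
  (\<open>besov_locally_polynomial\<close>).  For \<open>r \<notin> \<nat>\<close> this is Taylor's formula; for \<open>r \<in> \<nat>\<close> it rests on
  the fact that Zygmund functions are locally affine up to an error of order \<open>d\<close>
  (\<open>zygmund_locally_affine\<close>).  Since \<open>r < v\<close>, the vanishing moments of a wavelet of level \<open>j\<close>
  annihilate this polynomial, and its support, of length at most a multiple of \<open>2\<close> to the power
  \<open>-j\<close>, gives the decay of the coefficients.  The frame expansion of \<open>f\<close> holds locally because, over a
  compact set, only wavelets supported near that set contribute, so \<open>f\<close> may be truncated to a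
  square-integrable function (\<open>parseval_frame_L2loc\<close>).

  \<^bold>\<open>Synthesis.\<close>  Given admissible coefficients, group the series by levels.  Boundedly many
  wavelets of a level are active at any point, so the derivative of order \<open>i\<close> of level \<open>j\<close> is
  bounded by a multiple of \<open>2\<close> to the power \<open>-j (r - i)\<close>.  Hence the series may be differentiated
  termwise as long as \<open>i < r\<close>.  The remaining Hoelder or Zygmund condition comes from balancing, at
  scale \<open>h\<close>, this decaying bound against the one that the smoothness \<open>s > r\<close> of the wavelets
  provides; the two bounds cross at \<open>2\<^sup>j \<approx> 1/h\<close> (\<open>dyadic_interpolation_sum\<close>,
  \<open>expansion_besov\<close>).  The unordered series converges to the sum uniformly on compact sets
  (\<open>partial_sums_uniform\<close>).

  Finally, sums in local square mean are unique almost everywhere (\<open>L2loc_has_sum_unique\<close>), so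
  \<^emph>\<open>every\<close> function represented by admissible coefficients agrees almost everywhere with the Besov
  function that synthesis produces.
\<close>

section \<open>Pointwise forms of the norms\<close>

lemma zero_off_supp: "x \<notin> supp f \<Longrightarrow> f x = 0"
  unfolding supp_def using closure_subset[of "{x. f x \<noteq> 0}"] by blast

text \<open>The complement of the support is open, so a function that vanishes there has all its
  derivatives vanish there.  Local finiteness of the system thus passes to all derivatives.\<close>

lemma higher_deriv_zero_off_supp:
  assumes "x \<notin> supp f"
  shows "(deriv ^^ i) f x = 0"
  using assms
proof (induction i arbitrary: x)
  case 0
  then show ?case by (simp add: zero_off_supp)
next
  case (Suc i)
  have "((\<lambda>_. 0) has_field_derivative 0) (at x)" by simp
  then have "((deriv ^^ i) f has_field_derivative 0) (at x)"
    by (rule has_field_derivative_transform_within_open[of _ _ _ "- supp f"])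
      (use Suc in \<open>auto simp: supp_def\<close>)
  then show ?case by (simp add: DERIV_imp_deriv)
qed

text \<open>A nonempty open set is not null: for continuous functions an almost everywhere bound, as
  expressed by the essential supremum, is a bound everywhere.\<close>

lemma continuous_AE_le_imp_le:
  fixes g :: "real \<Rightarrow> real"
  assumes cont: "continuous_on UNIV g" and AE: "AE x in lborel. g x \<le> B"
  shows "g x \<le> B"
proof (rule ccontr)
  assume "\<not> g x \<le> B"
  let ?U = "{x. B < g x}"
  have "open ?U"
    by (rule open_Collect_less) (use cont in auto)
  moreover have "?U \<in> null_sets lborel"
    using AE \<open>open ?U\<close> by (subst AE_iff_null_sets) (auto simp: not_less)
  then have "negligible ?U"
    by (simp add: negligible_iff_null_sets null_sets_completionI)
  ultimately have "?U = {}" using open_not_negligible by blast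
  with \<open>\<not> g x \<le> B\<close> show False by (auto simp: not_le)
qed

lemma Linf_norm_le_imp_abs_le:
  assumes "continuous_on UNIV g" "Linf_norm g \<le> ennreal B" "0 \<le> B"
  shows "\<bar>g x\<bar> \<le> B"
proof -
  have "AE x in lborel. ennreal \<bar>g x\<bar> \<le> ennreal B"
    using esssup_AE[where M=lborel and f="\<lambda>x. ennreal \<bar>g x\<bar>"] assms(2)
    by (auto simp: Linf_norm_def elim!: eventually_mono)
  then have "AE x in lborel. \<bar>g x\<bar> \<le> B"
    using assms(3) by simp
  with assms(1) show ?thesis
    by (intro continuous_AE_le_imp_le[where g="\<lambda>x. \<bar>g x\<bar>"] continuous_intros) auto
qed

lemma continuous_Linf_iff:
  assumes "continuous_on UNIV f"
  shows "f \<in> Linf \<longleftrightarrow> (\<exists>B\<ge>0. \<forall>x. \<bar>f x\<bar> \<le> B)"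
proof
  assume "f \<in> Linf"
  then obtain B where "0 \<le> B" "Linf_norm f = ennreal B"
    by (auto simp: Linf_def less_top_ennreal)
  then show "\<exists>B\<ge>0. \<forall>x. \<bar>f x\<bar> \<le> B"
    using Linf_norm_le_imp_abs_le[OF assms] by fastforce
next
  assume "\<exists>B\<ge>0. \<forall>x. \<bar>f x\<bar> \<le> B"
  then obtain B where B: "\<And>x. \<bar>f x\<bar> \<le> B" by blast
  have m: "f \<in> borel_measurable lborel"
    using assms by (simp add: borel_measurable_continuous_onI)
  then have "Linf_norm f \<le> ennreal B"
    unfolding Linf_norm_def using B by (intro esssup_I) (auto intro: ennreal_leI)
  then have "Linf_norm f < \<infinity>"
    using ennreal_less_top[of B] by (simp add: le_less_trans)
  with m show "f \<in> Linf" by (simp add: Linf_def)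
qed

lemma holder_seminorm_le_iff:
  assumes "0 \<le> B"
  shows "holder_seminorm \<alpha> g \<le> ennreal B \<longleftrightarrow> (\<forall>x y. \<bar>g x - g y\<bar> \<le> B * \<bar>x - y\<bar> powr \<alpha>)"
proof -
  have "holder_seminorm \<alpha> g \<le> ennreal B \<longleftrightarrow>
      (\<forall>x h. h \<noteq> 0 \<longrightarrow> \<bar>g (x + h) - g x\<bar> \<le> B * \<bar>h\<bar> powr \<alpha>)"
    using assms by (auto simp: holder_seminorm_def SUP_le_iff divide_le_eq)
  also have "\<dots> \<longleftrightarrow> (\<forall>x y. \<bar>g x - g y\<bar> \<le> B * \<bar>x - y\<bar> powr \<alpha>)"
  proof (intro iffI allI impI)
    fix x y assume *: "\<forall>x h. h \<noteq> 0 \<longrightarrow> \<bar>g (x + h) - g x\<bar> \<le> B * \<bar>h\<bar> powr \<alpha>"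
    show "\<bar>g x - g y\<bar> \<le> B * \<bar>x - y\<bar> powr \<alpha>"
      using *[rule_format, of "x - y" y] by (cases "x = y") auto
  next
    fix x h :: real assume "\<forall>x y. \<bar>g x - g y\<bar> \<le> B * \<bar>x - y\<bar> powr \<alpha>"
    from this[rule_format, of "x + h" x] show "\<bar>g (x + h) - g x\<bar> \<le> B * \<bar>h\<bar> powr \<alpha>" by simp
  qed
  finally show ?thesis .
qed

lemma holder_seminorm_finite_iff:
  "holder_seminorm \<alpha> g < \<infinity> \<longleftrightarrow> (\<exists>B\<ge>0. \<forall>x y. \<bar>g x - g y\<bar> \<le> B * \<bar>x - y\<bar> powr \<alpha>)"
proof
  assume "holder_seminorm \<alpha> g < \<infinity>"
  then obtain B where "0 \<le> B" "holder_seminorm \<alpha> g = ennreal B"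
    by (auto simp: less_top_ennreal)
  then show "\<exists>B\<ge>0. \<forall>x y. \<bar>g x - g y\<bar> \<le> B * \<bar>x - y\<bar> powr \<alpha>"
    using holder_seminorm_le_iff[of B \<alpha> g] by auto
next
  assume "\<exists>B\<ge>0. \<forall>x y. \<bar>g x - g y\<bar> \<le> B * \<bar>x - y\<bar> powr \<alpha>"
  then obtain B where "holder_seminorm \<alpha> g \<le> ennreal B"
    using holder_seminorm_le_iff by blast
  then show "holder_seminorm \<alpha> g < \<infinity>"
    using ennreal_less_top[of B] by (simp add: le_less_trans)
qed

lemma zygmund_class_iff:
  "g \<in> zygmund_class \<longleftrightarrow> (\<exists>B\<ge>0. \<forall>x h. \<bar>g (x + h) - 2 * g x + g (x - h)\<bar> \<le> B * \<bar>h\<bar>)"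
proof -
  let ?S = "SUP (x, h) \<in> UNIV \<times> (- {0}). ennreal (\<bar>g (x + h) - 2 * g x + g (x - h)\<bar> / \<bar>h\<bar>)"
  have le: "?S \<le> ennreal B \<longleftrightarrow> (\<forall>x h. \<bar>g (x + h) - 2 * g x + g (x - h)\<bar> \<le> B * \<bar>h\<bar>)"
    if "0 \<le> B" for B
  proof -
    have "?S \<le> ennreal B \<longleftrightarrow>
        (\<forall>x h. h \<noteq> 0 \<longrightarrow> \<bar>g (x + h) - 2 * g x + g (x - h)\<bar> \<le> B * \<bar>h\<bar>)"
      using that by (auto simp: SUP_le_iff divide_le_eq)
    also have "\<dots> \<longleftrightarrow> (\<forall>x h. \<bar>g (x + h) - 2 * g x + g (x - h)\<bar> \<le> B * \<bar>h\<bar>)"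
    proof (intro iffI allI impI)
      fix x h assume "\<forall>x h. h \<noteq> 0 \<longrightarrow> \<bar>g (x + h) - 2 * g x + g (x - h)\<bar> \<le> B * \<bar>h\<bar>"
      then show "\<bar>g (x + h) - 2 * g x + g (x - h)\<bar> \<le> B * \<bar>h\<bar>" by (cases "h = 0") simp_all
    qed simp
    finally show ?thesis .
  qed
  show ?thesis
  proof
    assume "g \<in> zygmund_class"
    then obtain B where "0 \<le> B" "?S = ennreal B"
      by (auto simp: zygmund_class_def less_top_ennreal)
    then show "\<exists>B\<ge>0. \<forall>x h. \<bar>g (x + h) - 2 * g x + g (x - h)\<bar> \<le> B * \<bar>h\<bar>"
      using le[of B] by auto
  next
    assume "\<exists>B\<ge>0. \<forall>x h. \<bar>g (x + h) - 2 * g x + g (x - h)\<bar> \<le> B * \<bar>h\<bar>"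
    then obtain B where "?S \<le> ennreal B" using le by blast
    then show "g \<in> zygmund_class"
      using ennreal_less_top[of B] unfolding zygmund_class_def mem_Collect_eq infinity_ennreal_def
      by (rule le_less_trans)
  qed
qed

lemma C_nat_D:
  assumes "f \<in> C_nat n"
  shows "i < n \<Longrightarrow> ((deriv ^^ i) f has_field_derivative (deriv ^^ Suc i) f x) (at x)"
    and "i \<le> n \<Longrightarrow> continuous_on UNIV ((deriv ^^ i) f)"
proof -
  show *: "((deriv ^^ i) f has_field_derivative (deriv ^^ Suc i) f x) (at x)" if "i < n" for i x
    using assms that by (auto simp: C_nat_def DERIV_deriv_iff_real_differentiable)
  show "continuous_on UNIV ((deriv ^^ i) f)" if "i \<le> n"
  proof (cases "i = n")
    case True
    then show ?thesis using assms by (simp add: C_nat_def)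
  next
    case False
    with that have "i < n" by simp
    show ?thesis
      by (rule DERIV_continuous_on[where D = "(deriv ^^ Suc i) f"])
        (rule has_field_derivative_at_within[OF *[OF \<open>i < n\<close>]])
  qed
qed

lemma C_space_subset_C_nat: "C_space s \<subseteq> C_nat (nat \<lfloor>s\<rfloor>)"
  by (auto simp: C_space_def)

lemma C_norm_deriv_bound:
  assumes "f \<in> C_nat (nat \<lfloor>t\<rfloor>)" "C_norm t f \<le> ennreal B" "0 \<le> B" "i \<le> nat \<lfloor>t\<rfloor>"
  shows "\<bar>(deriv ^^ i) f x\<bar> \<le> B"
proof (rule Linf_norm_le_imp_abs_le[of "(deriv ^^ i) f"])
  show "continuous_on UNIV ((deriv ^^ i) f)" by (rule C_nat_D(2)[OF assms(1,4)])
  have "Linf_norm ((deriv ^^ i) f) \<le> (\<Sum>i\<le>nat \<lfloor>t\<rfloor>. Linf_norm ((deriv ^^ i) f))"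
    by (rule member_le_sum) (use assms(4) in auto)
  also have "\<dots> \<le> C_norm t f" by (simp add: C_norm_def)
  finally show "Linf_norm ((deriv ^^ i) f) \<le> ennreal B" using assms(2) by simp
qed (fact assms)

lemma C_norm_holder_bound:
  assumes "C_norm t f \<le> ennreal B" "0 \<le> B" "t \<notin> \<nat>"
  shows "\<bar>(deriv ^^ nat \<lfloor>t\<rfloor>) f x - (deriv ^^ nat \<lfloor>t\<rfloor>) f y\<bar> \<le> B * \<bar>x - y\<bar> powr frac t"
proof -
  have "holder_seminorm (frac t) ((deriv ^^ nat \<lfloor>t\<rfloor>) f) \<le> C_norm t f"
    using assms(3) by (simp add: C_norm_def)
  with assms(1) have "holder_seminorm (frac t) ((deriv ^^ nat \<lfloor>t\<rfloor>) f) \<le> ennreal B" by simp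
  then show ?thesis by (simp add: holder_seminorm_le_iff[OF assms(2)])
qed

section \<open>Local polynomial approximation of Besov functions\<close>

text \<open>A rate of approximation \<open>d\<^sup>\<rho>\<close> by polynomials of degree below \<open>n\<close>, uniformly over all
  intervals of length \<open>d\<close> (a Campanato condition).  For the coefficients against wavelets with
  \<open>v\<close> vanishing moments this is all that matters of membership in a Besov space.  A polynomial is
  a plain finite sum because the moment conditions are stated for monomials.\<close>

definition locally_polynomial :: "nat \<Rightarrow> real \<Rightarrow> real \<Rightarrow> (real \<Rightarrow> real) \<Rightarrow> bool" where
  "locally_polynomial n \<rho> M g \<longleftrightarrow>
     (\<forall>a d. 0 < d \<longrightarrow> (\<exists>c. \<forall>x\<in>{a..a + d}. \<bar>g x - (\<Sum>i<n. c i * x ^ i)\<bar> \<le> M * d powr \<rho>))"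

lemma locally_polynomial_mono:
  assumes "locally_polynomial m \<rho> M g" "m \<le> n"
  shows "locally_polynomial n \<rho> M g"
  unfolding locally_polynomial_def
proof (intro allI impI)
  fix a d :: real assume "0 < d"
  then obtain c where c: "\<forall>x\<in>{a..a + d}. \<bar>g x - (\<Sum>i<m. c i * x ^ i)\<bar> \<le> M * d powr \<rho>"
    using assms(1) unfolding locally_polynomial_def by blast
  have "(\<Sum>i<n. (if i < m then c i else 0) * x ^ i) = (\<Sum>i<m. c i * x ^ i)" for x :: real
    using assms(2) by (intro sum.mono_neutral_cong_right) auto
  with c have "\<forall>x\<in>{a..a + d}. \<bar>g x - (\<Sum>i<n. (if i < m then c i else 0) * x ^ i)\<bar> \<le> M * d powr \<rho>"
    by simp
  then show "\<exists>c. \<forall>x\<in>{a..a + d}. \<bar>g x - (\<Sum>i<n. c i * x ^ i)\<bar> \<le> M * d powr \<rho>"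
    by (rule exI[where x = "\<lambda>i. if i < m then c i else 0"])
qed

text \<open>Integrating the approximating polynomial, with the constant chosen to match \<open>g\<close> at the left
  end point, gains one degree and, by the mean value theorem, one power of the length.\<close>

lemma locally_polynomial_antiderivative:
  assumes g: "\<And>x. (g has_field_derivative g' x) (at x)"
    and g': "locally_polynomial n \<rho> M g'"
  shows "locally_polynomial (Suc n) (\<rho> + 1) M g"
  unfolding locally_polynomial_def
proof (intro allI impI)
  fix a d :: real assume d: "0 < d"
  then obtain c where c: "\<And>x. x \<in> {a..a + d} \<Longrightarrow> \<bar>g' x - (\<Sum>i<n. c i * x ^ i)\<bar> \<le> M * d powr \<rho>"
    using g' unfolding locally_polynomial_def by blast
  define P where "P x = (\<Sum>i<n. c i / real (Suc i) * x ^ Suc i)" for x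
  define c' where "c' = case_nat (g a - P a) (\<lambda>i. c i / real (Suc i))"
  have P: "(\<Sum>i<Suc n. c' i * x ^ i) = g a - P a + P x" for x
    by (simp add: sum.lessThan_Suc_shift c'_def P_def del: sum.lessThan_Suc)
  have dP: "(P has_field_derivative (\<Sum>i<n. c i * x ^ i)) (at x)" for x
    unfolding P_def
  proof (rule DERIV_sum)
    fix i
    show "((\<lambda>x. c i / real (Suc i) * x ^ Suc i) has_field_derivative c i * x ^ i) (at x)"
      using DERIV_cmult[OF DERIV_pow[of "Suc i" x], of "c i / real (Suc i)"] by simp
  qed
  have "\<bar>g x - (\<Sum>i<Suc n. c' i * x ^ i)\<bar> \<le> M * d powr (\<rho> + 1)" if x: "x \<in> {a..a + d}" for x
  proof (cases "x = a")
    case True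
    have "0 \<le> M * d powr \<rho>" using c[of a] d by force
    then have "0 \<le> M" using d by (simp add: zero_le_mult_iff)
    with True show ?thesis using P by simp
  next
    case False
    with x have "a < x" by simp
    have dgP: "((\<lambda>x. g x - P x) has_field_derivative g' x - (\<Sum>i<n. c i * x ^ i)) (at x)" for x
      by (intro DERIV_diff g dP)
    then obtain z where z: "a < z" "z < x"
      "(g x - P x) - (g a - P a) = (x - a) * (g' z - (\<Sum>i<n. c i * z ^ i))"
      using MVT2[OF \<open>a < x\<close> dgP] by auto
    have "g x - (\<Sum>i<Suc n. c' i * x ^ i) = (x - a) * (g' z - (\<Sum>i<n. c i * z ^ i))"
      unfolding P z(3)[symmetric] by simp
    then have "\<bar>g x - (\<Sum>i<Suc n. c' i * x ^ i)\<bar> = (x - a) * \<bar>g' z - (\<Sum>i<n. c i * z ^ i)\<bar>"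
      using \<open>a < x\<close> by (simp add: abs_mult)
    also have "\<dots> \<le> d * (M * d powr \<rho>)"
      using x z c[of z] by (intro mult_mono) auto
    also have "\<dots> = M * d powr (\<rho> + 1)" using d by (simp add: powr_add)
    finally show ?thesis .
  qed
  then show "\<exists>c. \<forall>x\<in>{a..a + d}. \<bar>g x - (\<Sum>i<Suc n. c i * x ^ i)\<bar> \<le> M * d powr (\<rho> + 1)" by blast
qed

lemma locally_polynomial_iterated:
  assumes "f \<in> C_nat m" "locally_polynomial n \<rho> M ((deriv ^^ m) f)"
  shows "locally_polynomial (n + m) (\<rho> + real m) M f"
proof -
  have "locally_polynomial (n + k) (\<rho> + real k) M ((deriv ^^ (m - k)) f)" if "k \<le> m" for k
    using that
  proof (induction k)
    case 0
    then show ?case using assms(2) by simp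
  next
    case (Suc k)
    have "((deriv ^^ (m - Suc k)) f has_field_derivative (deriv ^^ (m - k)) f x) (at x)" for x
      using C_nat_D(1)[OF assms(1), of "m - Suc k" x] Suc.prems by (simp add: Suc_diff_Suc del: funpow.simps)
    moreover have "locally_polynomial (n + k) (\<rho> + real k) M ((deriv ^^ (m - k)) f)"
      using Suc by simp
    ultimately have "locally_polynomial (Suc (n + k)) (\<rho> + real k + 1) M ((deriv ^^ (m - Suc k)) f)"
      by (rule locally_polynomial_antiderivative)
    then show ?case by (simp add: algebra_simps)
  qed
  from this[of m] show ?thesis by simp
qed

lemma holder_locally_constant:
  assumes "\<forall>x y. \<bar>g x - g y\<bar> \<le> M * \<bar>x - y\<bar> powr \<alpha>" "0 \<le> M" "0 \<le> \<alpha>"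
  shows "locally_polynomial 1 \<alpha> M g"
  unfolding locally_polynomial_def
proof (intro allI impI)
  fix a d :: real assume "0 < d"
  have "\<bar>g x - g a\<bar> \<le> M * d powr \<alpha>" if "x \<in> {a..a + d}" for x
  proof -
    have "\<bar>g x - g a\<bar> \<le> M * \<bar>x - a\<bar> powr \<alpha>" using assms(1) by blast
    also have "\<dots> \<le> M * d powr \<alpha>" using assms that by (intro mult_left_mono powr_mono2) auto
    finally show ?thesis .
  qed
  then show "\<exists>c. \<forall>x\<in>{a..a + d}. \<bar>g x - (\<Sum>i<1. c i * x ^ i)\<bar> \<le> M * d powr \<alpha>"
    by (intro exI[of _ "\<lambda>_. g a"]) simp
qed

text \<open>Subtract from \<open>g\<close> its affine interpolant at the two end points; second differences are
  unchanged.  Let the remainder \<open>u\<close> be largest in modulus at \<open>x\<^sub>0\<close>, and let \<open>h\<close> be the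
  distance from \<open>x\<^sub>0\<close> to the nearer end point, where \<open>u\<close> vanishes.  The point opposite to it lies
  in the interval as well, so the second difference at \<open>x\<^sub>0\<close> has modulus at least
  \<open>2\<bar>u x\<^sub>0\<bar> - \<bar>u x\<^sub>0\<bar>\<close>.\<close>

lemma zygmund_locally_affine:
  assumes cont: "continuous_on UNIV g"
    and M: "\<And>x h. \<bar>g (x + h) - 2 * g x + g (x - h)\<bar> \<le> M * \<bar>h\<bar>" "0 \<le> M"
  shows "locally_polynomial 2 1 M g"
  unfolding locally_polynomial_def
proof (intro allI impI)
  fix a d :: real assume d: "0 < d"
  define m where "m = (g (a + d) - g a) / d"
  define u where "u x = g x - (g a + m * (x - a))" for x
  have ends: "u a = 0" "u (a + d) = 0" using d by (auto simp: u_def m_def)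
  have "continuous_on {a..a + d} (\<lambda>x. \<bar>u x\<bar>)"
    unfolding u_def by (intro continuous_intros continuous_on_subset[OF cont]) auto
  then obtain x0 where x0: "x0 \<in> {a..a + d}" and max: "\<And>y. y \<in> {a..a + d} \<Longrightarrow> \<bar>u y\<bar> \<le> \<bar>u x0\<bar>"
    using continuous_attains_sup[of "{a..a + d}" "\<lambda>x. \<bar>u x\<bar>"] d by auto
  have second: "\<bar>u (x + h) - 2 * u x + u (x - h)\<bar> \<le> M * \<bar>h\<bar>" for x h
    using M(1)[of x h] by (simp add: u_def algebra_simps)
  have "\<bar>u x0\<bar> \<le> M * d"
  proof (cases "x0 \<le> a + d / 2")
    case True
    have "\<bar>u (x0 + (x0 - a))\<bar> \<le> \<bar>u x0\<bar>" using x0 True by (intro max) (auto simp: field_simps)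
    moreover have "M * \<bar>x0 - a\<bar> \<le> M * d" using x0 M by (intro mult_left_mono) auto
    ultimately show ?thesis using second[of x0 "x0 - a"] ends by auto
  next
    case False
    have "\<bar>u (x0 - (a + d - x0))\<bar> \<le> \<bar>u x0\<bar>" using x0 False by (intro max) (auto simp: field_simps)
    moreover have "M * \<bar>a + d - x0\<bar> \<le> M * d" using x0 M by (intro mult_left_mono) auto
    ultimately show ?thesis using second[of x0 "a + d - x0"] ends by auto
  qed
  then have *: "\<bar>u x\<bar> \<le> M * d" if "x \<in> {a..a + d}" for x
    using max[OF that] by linarith
  have "g x - (\<Sum>i<2. (if i = 0 then g a - m * a else m) * x ^ i) = u x" for x
    by (simp add: u_def numeral_2_eq_2 algebra_simps)
  with * d show "\<exists>c. \<forall>x\<in>{a..a + d}. \<bar>g x - (\<Sum>i<2. c i * x ^ i)\<bar> \<le> M * d powr 1"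
    by (intro exI[of _ "\<lambda>i. if i = 0 then g a - m * a else m"]) simp
qed

text \<open>For \<open>r \<notin> \<nat>\<close> the top derivative is locally constant up to \<open>d\<close> to the power \<open>frac r\<close>;
  for \<open>r \<in> \<nat>\<close> the derivative of order \<open>r - 1\<close> is locally affine up to \<open>d\<close>.  Integrating back to
  \<open>f\<close> gives degree \<open>\<lfloor>r\<rfloor>\<close> in both cases, and \<open>r < v\<close> puts it below \<open>v\<close>.\<close>

lemma besov_locally_polynomial:
  assumes f: "f \<in> besov r" and r: "0 < r" "r < real v"
  shows "\<exists>M\<ge>0. locally_polynomial v r M f"
proof (cases "r \<in> \<nat>")
  case True
  then obtain n where n: "r = real n" by (auto elim: Nats_cases)
  with r have "0 < n" "n < v" by auto
  then obtain m where m: "n = Suc m" using gr0_implies_Suc by blast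
  have "r - 1 = real m" using n m by simp
  then have "f \<in> C_nat m"
    using f True by (auto simp: besov_def C_space_def)
  have "nat \<lfloor>r\<rfloor> - 1 = m" using n m by (metis diff_Suc_1 floor_of_nat nat_int)
  then have "(deriv ^^ m) f \<in> zygmund_class"
    using f True by (simp add: besov_def)
  then obtain M where M: "0 \<le> M"
      "\<And>x h. \<bar>(deriv ^^ m) f (x + h) - 2 * (deriv ^^ m) f x + (deriv ^^ m) f (x - h)\<bar> \<le> M * \<bar>h\<bar>"
    by (auto simp: zygmund_class_iff)
  have "locally_polynomial 2 1 M ((deriv ^^ m) f)"
    by (rule zygmund_locally_affine[OF C_nat_D(2)[OF \<open>f \<in> C_nat m\<close> order.refl]]) (fact M)+
  from locally_polynomial_iterated[OF \<open>f \<in> C_nat m\<close> this]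
  have "locally_polynomial v (1 + real m) M f"
    by (rule locally_polynomial_mono) (use \<open>n < v\<close> m in simp)
  with M(1) show ?thesis using n m by (auto simp: add.commute)
next
  case False
  define m where "m = nat \<lfloor>r\<rfloor>"
  have "m < v" using r by (simp add: m_def nat_less_iff floor_less_iff)
  have rm: "frac r + real m = r" using r by (simp add: m_def frac_def)
  have "f \<in> C_nat m" "holder_seminorm (frac r) ((deriv ^^ m) f) < \<infinity>"
    using f False by (auto simp: besov_def C_space_def m_def)
  then obtain M where M: "0 \<le> M"
      "\<forall>x y. \<bar>(deriv ^^ m) f x - (deriv ^^ m) f y\<bar> \<le> M * \<bar>x - y\<bar> powr frac r"
    unfolding holder_seminorm_finite_iff by blast
  have "locally_polynomial 1 (frac r) M ((deriv ^^ m) f)"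
    by (rule holder_locally_constant[OF M(2,1)]) simp
  from locally_polynomial_iterated[OF \<open>f \<in> C_nat m\<close> this]
  have "locally_polynomial v r M f"
    unfolding rm by (rule locally_polynomial_mono) (use \<open>m < v\<close> in simp)
  with M(1) show ?thesis by blast
qed

lemma besov_continuous:
  assumes "f \<in> besov r" "0 < r"
  shows "continuous_on UNIV f"
proof -
  have "\<exists>t. f \<in> C_space t" using assms by (auto simp: besov_def split: if_splits)
  then obtain t where "f \<in> C_space t" by blast
  then have "f \<in> C_nat (nat \<lfloor>t\<rfloor>)" using C_space_subset_C_nat by blast
  from C_nat_D(2)[OF this, of 0] show ?thesis by simp
qed

lemma besov_bounded:
  assumes "f \<in> besov r" "0 < r"
  shows "\<exists>B\<ge>0. \<forall>x. \<bar>f x\<bar> \<le> B"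
  using continuous_Linf_iff[OF besov_continuous[OF assms]] assms
  by (auto simp: besov_def split: if_splits)

section \<open>Summing dyadic estimates\<close>

lemma two_powr_neg_summable:
  fixes \<alpha> :: real
  assumes "0 < \<alpha>"
  shows "summable (\<lambda>j. 2 powr (- (real j * \<alpha>)))"
proof -
  have "(\<lambda>j. 2 powr (- (real j * \<alpha>))) = (\<lambda>j. (2 powr (- \<alpha>)) ^ j)"
    by (auto simp: powr_powr mult.commute simp flip: powr_realpow)
  moreover have "2 powr (- \<alpha>) < (1::real)" using powr_less_mono[of "- \<alpha>" 0 2] assms by simp
  ultimately show ?thesis by (simp add: summable_geometric)
qed

lemma dyadic_geometric_tail_eq:
  fixes \<alpha> :: real
  assumes "0 < \<alpha>"
  shows "(\<Sum>j. 2 powr (- (real (j + J) * \<alpha>))) = 2 powr (- (real J * \<alpha>)) / (1 - 2 powr (- \<alpha>))"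
proof -
  have lt: "2 powr (- \<alpha>) < (1::real)" using powr_less_mono[of "- \<alpha>" 0 2] assms by simp
  have "(\<lambda>j. 2 powr (- (real (j + J) * \<alpha>))) = (\<lambda>j. 2 powr (- (real J * \<alpha>)) * (2 powr (- \<alpha>)) ^ j)"
    by (auto simp: powr_powr mult.commute algebra_simps simp flip: powr_realpow powr_add)
  moreover have "(\<Sum>j. (2 powr (- \<alpha>)) ^ j) = 1 / (1 - 2 powr (- \<alpha>))"
    using lt by (intro suminf_geometric) simp
  moreover have "summable (\<lambda>j. (2 powr (- \<alpha>)) ^ j)" using lt by (simp add: summable_geometric)
  ultimately show ?thesis by (simp add: suminf_mult)
qed

lemma dyadic_geometric_head_le:
  fixes \<beta> h :: real
  assumes "0 < \<beta>" "0 < h" and J: "\<And>j. j < J \<Longrightarrow> 2 ^ j * h \<le> 1"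
  shows "(\<Sum>j<J. 2 powr (real j * \<beta>)) \<le> 2 powr \<beta> / (2 powr \<beta> - 1) * h powr (- \<beta>)"
proof (cases J)
  case 0
  have "0 \<le> 2 powr \<beta> / (2 powr \<beta> - 1) * h powr (- \<beta>)"
    by (intro mult_nonneg_nonneg divide_nonneg_nonneg) (use ge_one_powr_ge_zero[of 2 \<beta>] assms(1) in auto)
  then show ?thesis by (simp add: 0)
next
  case (Suc i)
  let ?\<rho> = "2 powr \<beta> :: real"
  have \<rho>: "1 < ?\<rho>" using assms(1) by simp
  have "(\<Sum>j<J. 2 powr (real j * \<beta>)) = (\<Sum>j<J. ?\<rho> ^ j)"
    by (auto simp: powr_powr mult.commute simp flip: powr_realpow)
  also have "\<dots> = (?\<rho> ^ J - 1) / (?\<rho> - 1)"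
    by (rule geometric_sum) (use \<rho> in linarith)
  also have "\<dots> \<le> ?\<rho> ^ J / (?\<rho> - 1)"
    using \<rho> by (intro divide_right_mono) auto
  also have "\<dots> = ?\<rho> / (?\<rho> - 1) * ?\<rho> ^ i" by (simp add: Suc)
  also have "?\<rho> ^ i = (2 ^ i) powr \<beta>"
    by (auto simp: powr_powr mult.commute simp flip: powr_realpow)
  also have "?\<rho> / (?\<rho> - 1) * (2 ^ i) powr \<beta> \<le> ?\<rho> / (?\<rho> - 1) * h powr (- \<beta>)"
  proof (rule mult_left_mono)
    have "(2 ^ i :: real) powr \<beta> \<le> (1 / h) powr \<beta>"
      using J[of i] Suc assms by (intro powr_mono2) (auto simp: field_simps)
    also have "\<dots> = h powr (- \<beta>)" using assms by (simp add: powr_minus powr_divide field_simps)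
    finally show "(2 ^ i) powr \<beta> \<le> h powr (- \<beta>)" .
    show "0 \<le> ?\<rho> / (?\<rho> - 1)" by (rule divide_nonneg_nonneg) (use \<rho> in linarith)+
  qed
  finally show ?thesis .
qed

text \<open>The interpolation step behind every smoothness estimate below.  Of the two bounds for the
  contribution of level \<open>j\<close>, the decaying one is better when \<open>2\<^sup>j h > 1\<close> and the growing one when
  \<open>2\<^sup>j h \<le> 1\<close>.  Both geometric sums are dominated by their term at the crossover
  \<open>2\<^sup>j \<approx> 1/h\<close>, which is of size \<open>h\<^sup>\<alpha>\<close>.\<close>

lemma dyadic_interpolation_sum:
  fixes \<alpha> \<gamma> :: real
  assumes \<alpha>: "0 < \<alpha>" "\<alpha> < \<gamma>"
  obtains C where "0 \<le> C"
    "\<And>D M h. (\<And>j. \<bar>D j\<bar> \<le> M * 2 powr (- (real j * \<alpha>))) \<Longrightarrow>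
      (\<And>j. \<bar>D j\<bar> \<le> M * h powr \<gamma> * 2 powr (real j * (\<gamma> - \<alpha>))) \<Longrightarrow> 0 < h \<Longrightarrow> 0 \<le> M \<Longrightarrow>
      \<bar>\<Sum>j. D j\<bar> \<le> M * C * h powr \<alpha>"
proof
  let ?C1 = "2 powr (\<gamma> - \<alpha>) / (2 powr (\<gamma> - \<alpha>) - 1) :: real"
  let ?C2 = "1 / (1 - 2 powr (- \<alpha>)) :: real"
  let ?C = "?C1 + ?C2"
  have 1: "1 < (2 powr (\<gamma> - \<alpha>) :: real)" using \<alpha> by simp
  have 2: "2 powr (- \<alpha>) < (1::real)" using powr_less_mono[of "- \<alpha>" 0 2] \<alpha> by simp
  show "0 \<le> ?C" using 1 2 by simp
  fix D :: "nat \<Rightarrow> real" and M h :: real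
  assume hi: "\<And>j. \<bar>D j\<bar> \<le> M * 2 powr (- (real j * \<alpha>))"
    and lo: "\<And>j. \<bar>D j\<bar> \<le> M * h powr \<gamma> * 2 powr (real j * (\<gamma> - \<alpha>))"
    and h: "0 < h" and M: "0 \<le> M"
  \<comment> \<open>The crossover level; it is \<open>0\<close>, and the first sum empty, when \<open>h > 1\<close>.\<close>
  define J where "J = (LEAST j. 1 < 2 ^ j * h)"
  obtain n where "1 / h < 2 ^ n" using real_arch_pow[of 2 "1 / h"] by auto
  then have ex: "1 < 2 ^ n * h" using h by (simp add: field_simps)
  then have J1: "1 < 2 ^ J * h" unfolding J_def by (rule LeastI)
  have J2: "2 ^ j * h \<le> 1" if "j < J" for j
    using not_less_Least[of j "\<lambda>j. 1 < 2 ^ j * h"] that unfolding J_def by simp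
  have sm: "summable (\<lambda>j. M * 2 powr (- (real j * \<alpha>)))"
    by (intro summable_mult two_powr_neg_summable \<alpha>)
  have sD: "summable (\<lambda>j. \<bar>D j\<bar>)"
    by (rule summable_comparison_test'[OF sm]) (use hi in auto)
  have "\<bar>\<Sum>j. D j\<bar> \<le> (\<Sum>j. \<bar>D j\<bar>)" by (rule summable_rabs[OF sD])
  also have "\<dots> = (\<Sum>j. \<bar>D (j + J)\<bar>) + (\<Sum>j<J. \<bar>D j\<bar>)"
    by (rule suminf_split_initial_segment[OF sD])
  also have "(\<Sum>j. \<bar>D (j + J)\<bar>) \<le> (\<Sum>j. M * 2 powr (- (real (j + J) * \<alpha>)))"
    using hi summable_ignore_initial_segment[OF sD, of J] summable_ignore_initial_segment[OF sm, of J]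
    by (intro suminf_le hi) auto
  also have "\<dots> = M * (\<Sum>j. 2 powr (- (real (j + J) * \<alpha>)))"
    by (rule suminf_mult[OF summable_ignore_initial_segment[OF two_powr_neg_summable[OF \<alpha>(1)]]])
  also have "(\<Sum>j. 2 powr (- (real (j + J) * \<alpha>))) = 2 powr (- (real J * \<alpha>)) * ?C2"
    unfolding dyadic_geometric_tail_eq[OF \<alpha>(1)] by simp
  also have "2 powr (- (real J * \<alpha>)) = (2 powr (- real J)) powr \<alpha>"
    by (simp add: powr_powr)
  also have "2 powr (- real J) = 1 / (2 ^ J :: real)"
    by (simp add: powr_minus powr_realpow divide_inverse)
  also have "(\<Sum>j<J. \<bar>D j\<bar>) \<le> (\<Sum>j<J. M * h powr \<gamma> * 2 powr (real j * (\<gamma> - \<alpha>)))"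
    using lo by (intro sum_mono)
  also have "\<dots> = M * h powr \<gamma> * (\<Sum>j<J. 2 powr (real j * (\<gamma> - \<alpha>)))"
    by (simp add: sum_distrib_left)
  also have "\<dots> \<le> M * h powr \<gamma> * (?C1 * h powr (- (\<gamma> - \<alpha>)))"
    using \<alpha> h M J2 by (intro mult_left_mono dyadic_geometric_head_le) auto
  also have "\<dots> = M * (h powr \<alpha> * ?C1)"
    by (simp add: mult.assoc mult.left_commute[of _ "?C1"] flip: powr_add)
  finally have *: "\<bar>\<Sum>j. D j\<bar> \<le> M * ((1 / 2 ^ J) powr \<alpha> * ?C2) + M * (h powr \<alpha> * ?C1)"
    by simp
  have "(1 / 2 ^ J) powr \<alpha> \<le> h powr \<alpha>"
    using J1 h \<alpha> by (intro powr_mono2) (auto simp: field_simps)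
  then have "M * ((1 / 2 ^ J) powr \<alpha> * ?C2) \<le> M * (h powr \<alpha> * ?C2)"
    using 2 M by (intro mult_left_mono mult_right_mono) auto
  with * have "\<bar>\<Sum>j. D j\<bar> \<le> M * (h powr \<alpha> * ?C2) + M * (h powr \<alpha> * ?C1)" by linarith
  also have "\<dots> = M * ?C * h powr \<alpha>" by (simp only: ring_distribs mult_ac add.commute)
  finally show "\<bar>\<Sum>j. D j\<bar> \<le> M * ?C * h powr \<alpha>" .
qed

section \<open>Smoothness of wavelet expansions\<close>

text \<open>The second difference of \<open>g\<close> with step \<open>h\<close> is the increment over \<open>[x - h, x]\<close> of
  \<open>t \<mapsto> g (t + h) - g t\<close>, to which the mean value theorem applies.\<close>

lemma second_difference_holder_deriv:
  fixes g g' :: "real \<Rightarrow> real"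
  assumes g: "\<And>x. (g has_field_derivative g' x) (at x)"
    and g': "\<And>x y. \<bar>g' x - g' y\<bar> \<le> H * \<bar>x - y\<bar> powr \<beta>"
  shows "\<bar>g (x + h) - 2 * g x + g (x - h)\<bar> \<le> H * \<bar>h\<bar> powr (1 + \<beta>)"
proof -
  have pos: "\<bar>g (x + h) - 2 * g x + g (x - h)\<bar> \<le> H * h powr (1 + \<beta>)" if h: "0 < h" for h
  proof -
    define u where "u t = g (t + h) - g t" for t
    have du: "(u has_field_derivative g' (t + h) - g' t) (at t)" for t
      unfolding u_def
      by (intro DERIV_diff g) (use g[of "t + h"] DERIV_shift in blast)
    have "x - h < x" using h by simp
    from MVT2[OF this du] obtain z where "u x - u (x - h) = h * (g' (z + h) - g' z)"
      by auto
    moreover have "g (x + h) - 2 * g x + g (x - h) = u x - u (x - h)" by (simp add: u_def)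
    ultimately have "\<bar>g (x + h) - 2 * g x + g (x - h)\<bar> = h * \<bar>g' (z + h) - g' z\<bar>"
      using h by (simp add: abs_mult)
    also have "\<dots> \<le> h * (H * h powr \<beta>)"
      using h g'[of "z + h" z] by (intro mult_left_mono) auto
    also have "\<dots> = H * h powr (1 + \<beta>)" using h by (simp add: powr_add)
    finally show ?thesis .
  qed
  consider "h = 0" | "0 < h" | "0 < - h" by linarith
  then show ?thesis
  proof cases
    case 3
    then show ?thesis using pos[of "- h"] by (simp add: algebra_simps)
  qed (use pos in auto)
qed

text \<open>The order \<open>l\<close> is the integer part of \<open>r\<close>, and \<open>\<beta> > r - l\<close> is a Hoelder exponent for the
  derivatives of order \<open>l\<close> of the wavelets: the smoothness of the system must exceed \<open>r\<close> strictly
  for the growing bounds in \<open>dyadic_interpolation_sum\<close>.  When \<open>r\<close> is an integer, \<open>r = l\<close> and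
  the derivative of order \<open>l\<close> of the sum need not exist.\<close>

locale wavelet_expansion =
  fixes e :: "nat \<Rightarrow> int \<Rightarrow> real \<Rightarrow> real" and c :: "nat \<Rightarrow> int \<Rightarrow> real"
    and r \<beta> A B :: real and l N :: nat
  assumes r_pos: "0 < r" and l_le_r: "real l \<le> r" and r_less: "r < real l + 1"
    and \<beta>: "r - real l < \<beta>"
    and A: "0 \<le> A" and B: "0 \<le> B"
    and smooth: "\<And>j k. e j k \<in> C_nat l"
    and deriv_bound: "\<And>j k i x. i \<le> l \<Longrightarrow>
          \<bar>(deriv ^^ i) (e j k) x\<bar> \<le> A * 2 powr (real j * (real i + 1/2))"
    and holder_bound: "\<And>j k x y. \<bar>(deriv ^^ l) (e j k) x - (deriv ^^ l) (e j k) y\<bar>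
          \<le> A * 2 powr (real j * (real l + \<beta> + 1/2)) * \<bar>x - y\<bar> powr \<beta>"
    and locally_finite: "\<And>j a b. finite {k. supp (e j k) \<inter> {a..b} \<noteq> {}}"
    and overlap: "\<And>j x. card {k. x \<in> supp (e j k)} \<le> N"
    and coeff_bound: "\<And>j k. \<bar>c j k\<bar> \<le> B * 2 powr (- (real j * (r + 1/2)))"
begin

definition active :: "nat \<Rightarrow> real \<Rightarrow> int set" where
  "active j x = {k. x \<in> supp (e j k)}"

definition level :: "nat \<Rightarrow> nat \<Rightarrow> real \<Rightarrow> real" where
  "level j i x = (\<Sum>k\<in>active j x. c j k * (deriv ^^ i) (e j k) x)"

definition expansion :: "nat \<Rightarrow> real \<Rightarrow> real" where
  "expansion i x = (\<Sum>j. level j i x)"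

text \<open>At every point at most \<open>N\<close> terms of a level are nonzero, and each is at most \<open>A B\<close> times
  the dyadic factor of the level.\<close>

definition M :: real where "M = real N * (A * B)"

lemma M_nonneg: "0 \<le> M"
  using A B by (simp add: M_def)

lemma finite_active: "finite (active j x)"
  using locally_finite[of j x x] by (simp add: active_def)

lemma inactive: "k \<notin> active j x \<Longrightarrow> (deriv ^^ i) (e j k) x = 0"
  by (simp add: active_def higher_deriv_zero_off_supp)

lemma level_eq:
  assumes "finite G" "active j x \<subseteq> G"
  shows "level j i x = (\<Sum>k\<in>G. c j k * (deriv ^^ i) (e j k) x)"
  unfolding level_def using assms inactive by (intro sum.mono_neutral_left) auto

lemma finite_level_near:
  obtains G where "finite G" "\<And>y. y \<in> ball x 1 \<Longrightarrow> active j y \<subseteq> G"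
proof
  show "finite {k. supp (e j k) \<inter> {x - 1..x + 1} \<noteq> {}}" by (rule locally_finite)
  fix y assume "y \<in> ball x 1"
  then have "y \<in> {x - 1..x + 1}" by (auto simp: dist_real_def)
  then show "active j y \<subseteq> {k. supp (e j k) \<inter> {x - 1..x + 1} \<noteq> {}}" by (auto simp: active_def)
qed

lemma level_deriv:
  assumes "i < l"
  shows "(level j i has_field_derivative level j (Suc i) x) (at x)"
proof -
  obtain G where G: "finite G" "\<And>y. y \<in> ball x 1 \<Longrightarrow> active j y \<subseteq> G" using finite_level_near[of x j] by blast
  have "((\<lambda>y. \<Sum>k\<in>G. c j k * (deriv ^^ i) (e j k) y) has_field_derivative
      (\<Sum>k\<in>G. c j k * (deriv ^^ Suc i) (e j k) x)) (at x)"
    by (intro DERIV_sum DERIV_cmult C_nat_D(1)[OF smooth assms])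
  then have "(level j i has_field_derivative (\<Sum>k\<in>G. c j k * (deriv ^^ Suc i) (e j k) x)) (at x)"
    by (rule has_field_derivative_transform_within_open[of _ _ _ "ball x 1"])
      (use level_eq[OF G] in auto)
  then show ?thesis using level_eq[OF G, of x "Suc i"] by simp
qed

lemma level_continuous:
  assumes "i \<le> l"
  shows "continuous_on UNIV (level j i)"
proof -
  have "isCont (level j i) x" for x
  proof -
    obtain G where G: "finite G" "\<And>y. y \<in> ball x 1 \<Longrightarrow> active j y \<subseteq> G" using finite_level_near[of x j] by blast
    have "isCont (\<lambda>y. \<Sum>k\<in>G. c j k * (deriv ^^ i) (e j k) y) x"
      using C_nat_D(2)[OF smooth assms] by (intro continuous_intros) (auto simp: continuous_on_eq_continuous_at)
    moreover have "\<forall>\<^sub>F y in nhds x. y \<in> ball x 1"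
      by (rule eventually_nhds_in_open) auto
    then have "\<forall>\<^sub>F y in nhds x. level j i y = (\<Sum>k\<in>G. c j k * (deriv ^^ i) (e j k) y)"
      by (rule eventually_mono) (rule level_eq[OF G])
    ultimately show ?thesis by (simp add: isCont_cong)
  qed
  then show ?thesis by (simp add: continuous_at_imp_continuous_on)
qed

lemma term_bound:
  assumes "i \<le> l"
  shows "\<bar>c j k * (deriv ^^ i) (e j k) x\<bar> \<le> A * B * 2 powr (- (real j * (r - real i)))"
proof -
  have "\<bar>c j k * (deriv ^^ i) (e j k) x\<bar>
      \<le> (B * 2 powr (- (real j * (r + 1/2)))) * (A * 2 powr (real j * (real i + 1/2)))"
    unfolding abs_mult by (intro mult_mono coeff_bound deriv_bound assms) (use B in auto)
  also have "\<dots> = A * B * (2 powr (- (real j * (r + 1/2))) * 2 powr (real j * (real i + 1/2)))"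
    by simp
  also have "2 powr (- (real j * (r + 1/2))) * 2 powr (real j * (real i + 1/2))
      = (2::real) powr (- (real j * (r - real i)))"
    unfolding powr_add[symmetric] by (rule arg_cong[where f = "\<lambda>t. 2 powr t"]) (simp add: algebra_simps)
  finally show ?thesis .
qed

text \<open>Stated for arbitrary finite sets of indices, since it also has to control what a partial sum
  omits.\<close>

lemma partial_level_bound:
  assumes "finite S" "i \<le> l"
  shows "\<bar>\<Sum>k\<in>S. c j k * (deriv ^^ i) (e j k) x\<bar> \<le> M * 2 powr (- (real j * (r - real i)))"
proof -
  have "(\<Sum>k\<in>S. c j k * (deriv ^^ i) (e j k) x) = (\<Sum>k\<in>S \<inter> active j x. c j k * (deriv ^^ i) (e j k) x)"
    using assms(1) inactive by (intro sum.mono_neutral_right) auto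
  also have "\<bar>\<dots>\<bar> \<le> real (card (S \<inter> active j x)) * (A * B * 2 powr (- (real j * (r - real i))))"
    using sum_norm_bound[of "S \<inter> active j x" "\<lambda>k. c j k * (deriv ^^ i) (e j k) x"] term_bound[OF assms(2)]
    by auto
  also have "\<dots> \<le> real N * (A * B * 2 powr (- (real j * (r - real i))))"
  proof (rule mult_right_mono)
    have "card (S \<inter> active j x) \<le> card (active j x)" by (simp add: card_mono finite_active)
    also have "\<dots> \<le> N" using overlap by (simp add: active_def)
    finally show "real (card (S \<inter> active j x)) \<le> real N" by simp
  qed (use A B in simp)
  finally show ?thesis by (simp add: M_def mult.assoc)
qed

lemma level_bound:
  assumes "i \<le> l"
  shows "\<bar>level j i x\<bar> \<le> M * 2 powr (- (real j * (r - real i)))"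
  unfolding level_def by (rule partial_level_bound[OF finite_active assms])

text \<open>An increment between \<open>x\<close> and \<open>y\<close> involves only the wavelets active at \<open>x\<close> or at \<open>y\<close>,
  hence the factor \<open>2\<close>.\<close>

lemma level_holder:
  "\<bar>level j l x - level j l y\<bar> \<le> 2 * M * \<bar>x - y\<bar> powr \<beta> * 2 powr (real j * (\<beta> - (r - real l)))"
proof -
  let ?G = "active j x \<union> active j y"
  let ?t = "A * B * (2 powr (real j * (\<beta> - (r - real l))) * \<bar>x - y\<bar> powr \<beta>)"
  have fin: "finite ?G" by (simp add: finite_active)
  have "\<bar>c j k * ((deriv ^^ l) (e j k) x - (deriv ^^ l) (e j k) y)\<bar> \<le> ?t" for k
  proof -
    have "\<bar>c j k * ((deriv ^^ l) (e j k) x - (deriv ^^ l) (e j k) y)\<bar>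
        \<le> (B * 2 powr (- (real j * (r + 1/2)))) *
           (A * 2 powr (real j * (real l + \<beta> + 1/2)) * \<bar>x - y\<bar> powr \<beta>)"
      unfolding abs_mult by (intro mult_mono coeff_bound holder_bound) (use B in auto)
    also have "\<dots> = A * B * ((2 powr (- (real j * (r + 1/2))) * 2 powr (real j * (real l + \<beta> + 1/2)))
        * \<bar>x - y\<bar> powr \<beta>)"
      by simp
    also have "2 powr (- (real j * (r + 1/2))) * 2 powr (real j * (real l + \<beta> + 1/2))
        = (2::real) powr (real j * (\<beta> - (r - real l)))"
      unfolding powr_add[symmetric] by (rule arg_cong[where f = "\<lambda>t. 2 powr t"]) (simp add: algebra_simps)
    finally show ?thesis .
  qed
  then have "\<bar>\<Sum>k\<in>?G. c j k * ((deriv ^^ l) (e j k) x - (deriv ^^ l) (e j k) y)\<bar> \<le> real (card ?G) * ?t"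
    using sum_norm_bound[of ?G "\<lambda>k. c j k * ((deriv ^^ l) (e j k) x - (deriv ^^ l) (e j k) y)"] by auto
  also have "\<dots> \<le> real (2 * N) * ?t"
  proof (rule mult_right_mono)
    have "card ?G \<le> card (active j x) + card (active j y)" by (rule card_Un_le)
    also have "\<dots> \<le> 2 * N" using overlap[of x j] overlap[of y j] by (simp add: active_def)
    finally show "real (card ?G) \<le> real (2 * N)" by linarith
  qed (use A B in simp)
  also have "(\<Sum>k\<in>?G. c j k * ((deriv ^^ l) (e j k) x - (deriv ^^ l) (e j k) y)) = level j l x - level j l y"
    using level_eq[OF fin, of j x l] level_eq[OF fin, of j y l]
    by (simp add: right_diff_distrib sum_subtractf)
  finally show ?thesis by (simp add: M_def mult_ac)
qed

lemma level_bound_summable: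
  assumes "real i < r"
  shows "summable (\<lambda>j. M * 2 powr (- (real j * (r - real i))))"
  using assms by (intro summable_mult two_powr_neg_summable) simp

lemma le_l: "real i < r \<Longrightarrow> i \<le> l"
  using r_less by linarith

lemma level_summable:
  assumes "real i < r"
  shows "summable (\<lambda>j. level j i x)"
  by (rule summable_comparison_test'[OF level_bound_summable[OF assms]])
    (use level_bound[OF le_l[OF assms]] in auto)

lemma expansion_uniform_limit:
  assumes "real i < r"
  shows "uniform_limit UNIV (\<lambda>n x. \<Sum>j<n. level j i x) (expansion i) sequentially"
  unfolding expansion_def
  by (rule Weierstrass_m_test[OF _ level_bound_summable[OF assms]])
    (use level_bound[OF le_l[OF assms]] in auto)

lemma expansion_continuous:
  assumes "real i < r"
  shows "continuous_on UNIV (expansion i)"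
  by (rule uniform_limit_theorem[OF _ expansion_uniform_limit[OF assms]])
    (auto intro!: always_eventually continuous_on_sum level_continuous le_l[OF assms])

text \<open>The levels differentiated \<open>i + 1\<close> times are bounded by multiples of \<open>2\<close> to the power
  \<open>-j (r - i - 1)\<close>, so the differentiated series converges uniformly.\<close>

lemma expansion_deriv:
  assumes "real (Suc i) < r"
  shows "(expansion i has_field_derivative expansion (Suc i) x) (at x)"
proof -
  have i: "real i < r" "i < l" using assms le_l[OF assms] by auto
  have "(\<lambda>x. \<Sum>j. level j i x) = expansion i" "(\<Sum>j. level j (Suc i) x) = expansion (Suc i) x"
    by (auto simp: expansion_def)
  with has_field_derivative_series'(2)[of UNIV "\<lambda>j. level j i" "\<lambda>j. level j (Suc i)" x x]
  show ?thesis
    using level_deriv[OF i(2)] level_summable[OF i(1)] expansion_uniform_limit[OF assms]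
    by (auto simp: uniformly_convergent_on_def)
qed

lemma expansion_higher_deriv:
  assumes "real i < r"
  shows "(deriv ^^ i) (expansion 0) = expansion i"
  using assms
proof (induction i)
  case (Suc i)
  then have "(deriv ^^ i) (expansion 0) = expansion i" by simp
  then show ?case using DERIV_imp_deriv[OF expansion_deriv[OF Suc.prems]] by auto
qed simp

lemma expansion_C_nat:
  assumes "real m < r"
  shows "expansion 0 \<in> C_nat m"
proof -
  have "(deriv ^^ i) (expansion 0) differentiable (at x)" if "i < m" for i x
    using that assms expansion_deriv[of i x] expansion_higher_deriv[of i]
    by (auto simp: real_differentiable_def)
  moreover have "continuous_on UNIV ((deriv ^^ m) (expansion 0))"
    using assms by (simp add: expansion_higher_deriv expansion_continuous)
  ultimately show ?thesis by (simp add: C_nat_def)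
qed

lemma expansion_Linf: "expansion 0 \<in> Linf"
proof -
  have r: "real 0 < r" using r_pos by simp
  have "\<bar>expansion 0 x\<bar> \<le> (\<Sum>j. M * 2 powr (- (real j * (r - real 0))))" for x
    unfolding expansion_def real_norm_def[symmetric]
    by (rule norm_suminf_le[OF _ level_bound_summable[OF r]])
      (use level_bound[of 0] in auto)
  moreover have "0 \<le> (\<Sum>j. M * 2 powr (- (real j * (r - real 0))))"
    by (rule suminf_nonneg[OF level_bound_summable[OF r]]) (use M_nonneg in simp)
  ultimately show ?thesis
    unfolding continuous_Linf_iff[OF expansion_continuous[OF r]] by blast
qed

text \<open>Each level obeys the decaying bound of \<open>level_bound\<close> and the growing bound of
  \<open>level_holder\<close>; interpolate with \<open>\<alpha> = r - l\<close> and \<open>\<gamma> = \<beta>\<close>.\<close>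

lemma expansion_holder:
  assumes "real l < r"
  shows "holder_seminorm (r - real l) (expansion l) < \<infinity>"
proof -
  have "0 < r - real l" using assms by simp
  from dyadic_interpolation_sum[OF this \<beta>] obtain C where C: "0 \<le> C"
    "\<And>D M h. (\<And>j. \<bar>D j\<bar> \<le> M * 2 powr (- (real j * (r - real l)))) \<Longrightarrow>
      (\<And>j. \<bar>D j\<bar> \<le> M * h powr \<beta> * 2 powr (real j * (\<beta> - (r - real l)))) \<Longrightarrow> 0 < h \<Longrightarrow> 0 \<le> M \<Longrightarrow>
      \<bar>\<Sum>j. D j\<bar> \<le> M * C * h powr (r - real l)" by blast
  have "\<bar>expansion l x - expansion l y\<bar> \<le> 2 * M * C * \<bar>x - y\<bar> powr (r - real l)" for x y
  proof (cases "x = y")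
    case False
    have "expansion l x - expansion l y = (\<Sum>j. level j l x - level j l y)"
      unfolding expansion_def by (rule suminf_diff[OF level_summable[OF assms] level_summable[OF assms]])
    moreover have "\<bar>\<Sum>j. level j l x - level j l y\<bar> \<le> 2 * M * C * \<bar>x - y\<bar> powr (r - real l)"
    proof (rule C(2))
      show "\<bar>level j l x - level j l y\<bar> \<le> 2 * M * 2 powr (- (real j * (r - real l)))" for j
        using level_bound[of l j x] level_bound[of l j y] by simp
    qed (use level_holder M_nonneg False in auto)
    ultimately show ?thesis by simp
  qed simp
  then show ?thesis
    unfolding holder_seminorm_finite_iff using C(1) M_nonneg
    by (intro exI[of _ "2 * M * C"]) auto
qed

text \<open>For integer \<open>r\<close> the exponent \<open>r - l\<close> is \<open>0\<close> and the argument for the derivative of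
  order \<open>l\<close> breaks down.  One order lower, the second differences of a level gain a factor
  \<open>\<bar>h\<bar>\<close> to the power \<open>1 + \<beta>\<close>, an exponent above \<open>1\<close>; interpolate with \<open>\<alpha> = 1\<close> and
  \<open>\<gamma> = 1 + \<beta>\<close>.\<close>

lemma expansion_zygmund:
  assumes "r = real l"
  shows "expansion (l - 1) \<in> zygmund_class"
proof -
  obtain m where m: "l = Suc m" using assms r_pos by (cases l) auto
  have "0 < \<beta>" using \<beta> assms by simp
  then have "1 < 1 + \<beta>" by simp
  from dyadic_interpolation_sum[OF zero_less_one this] obtain C where C: "0 \<le> C"
    "\<And>D M h. (\<And>j. \<bar>D j\<bar> \<le> M * 2 powr (- (real j * 1))) \<Longrightarrow>
      (\<And>j. \<bar>D j\<bar> \<le> M * h powr (1 + \<beta>) * 2 powr (real j * (1 + \<beta> - 1))) \<Longrightarrow> 0 < h \<Longrightarrow> 0 \<le> M \<Longrightarrow>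
      \<bar>\<Sum>j. D j\<bar> \<le> M * C * h powr 1" by blast
  have mr: "real m < r" using assms m by simp
  note sm = level_summable[OF mr]
  have "\<bar>expansion m (x + h) - 2 * expansion m x + expansion m (x - h)\<bar> \<le> 4 * M * C * \<bar>h\<bar>" for x h
  proof (cases "h = 0")
    case False
    let ?D = "\<lambda>j. level j m (x + h) - 2 * level j m x + level j m (x - h)"
    have "?D sums (expansion m (x + h) - 2 * expansion m x + expansion m (x - h))"
      unfolding expansion_def by (intro sums_add sums_diff sums_mult summable_sums sm)
    then have "expansion m (x + h) - 2 * expansion m x + expansion m (x - h) = (\<Sum>j. ?D j)"
      by (rule sums_unique)
    moreover have "\<bar>\<Sum>j. ?D j\<bar> \<le> 4 * M * C * \<bar>h\<bar> powr 1"
    proof (rule C(2))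
      fix j
      have "r - real m = 1" using assms m by simp
      then show "\<bar>?D j\<bar> \<le> 4 * M * 2 powr (- (real j * 1))"
        using level_bound[of m j "x + h"] level_bound[of m j x] level_bound[of m j "x - h"] m
        by simp
      have "\<bar>?D j\<bar> \<le> (2 * M * 2 powr (real j * \<beta>)) * \<bar>h\<bar> powr (1 + \<beta>)"
      proof (rule second_difference_holder_deriv)
        show "(level j m has_field_derivative level j l x) (at x)" for x
          using level_deriv[of m j x] m by simp
        show "\<bar>level j l x - level j l y\<bar> \<le> 2 * M * 2 powr (real j * \<beta>) * \<bar>x - y\<bar> powr \<beta>" for x y
          using level_holder[of j x y] assms by (simp add: mult_ac)
      qed
      also have "\<dots> \<le> 4 * M * \<bar>h\<bar> powr (1 + \<beta>) * 2 powr (real j * (1 + \<beta> - 1))"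
        using M_nonneg by (simp add: mult_ac)
      finally show "\<bar>?D j\<bar> \<le> 4 * M * \<bar>h\<bar> powr (1 + \<beta>) * 2 powr (real j * (1 + \<beta> - 1))" .
    qed (use False M_nonneg in auto)
    ultimately show ?thesis using False by simp
  qed simp
  then show ?thesis
    unfolding zygmund_class_iff using C(1) M_nonneg m by (intro exI[of _ "4 * M * C"]) auto
qed

lemma expansion_besov: "expansion 0 \<in> besov r"
proof (cases "r \<in> \<nat>")
  case True
  then obtain n where n: "r = real n" by (auto elim: Nats_cases)
  with l_le_r r_less have rl: "r = real l" by auto
  then obtain m where m: "l = Suc m" using r_pos by (cases l) auto
  have mr: "real m < r" and r1: "r - 1 = real m" and fl: "nat \<lfloor>r\<rfloor> - 1 = m"
    using rl m by (auto simp: nat_add_distrib)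
  have "expansion 0 \<in> C_space (r - 1)" using expansion_C_nat[OF mr] by (simp add: C_space_def r1)
  moreover have "(deriv ^^ (nat \<lfloor>r\<rfloor> - 1)) (expansion 0) \<in> zygmund_class"
    unfolding fl expansion_higher_deriv[OF mr] using expansion_zygmund[OF rl] m by simp
  ultimately show ?thesis using True expansion_Linf by (simp add: besov_def)
next
  case False
  then have lr: "real l < r" using l_le_r by (metis of_nat_in_Nats order_le_imp_less_or_eq)
  then have fl: "nat \<lfloor>r\<rfloor> = l" using r_less by linarith
  have "\<lfloor>r\<rfloor> = int l" by (rule floor_unique) (use l_le_r r_less in auto)
  then have fr: "frac r = r - real l" by (simp add: frac_def)
  have "expansion 0 \<in> C_space r"
    using False expansion_C_nat[OF lr] expansion_holder[OF lr]
    by (simp add: C_space_def fl fr expansion_higher_deriv[OF lr])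
  then show ?thesis using False expansion_Linf by (simp add: besov_def)
qed

text \<open>Once a finite set of indices contains all wavelets of the levels below \<open>J\<close> that meet the
  interval, what it omits at a point of the interval lies in the levels from \<open>J\<close> on, and there
  its contribution is at most the tail of a geometric series.\<close>

lemma partial_sums_uniform:
  assumes "0 < \<epsilon>"
  obtains S0 where "finite S0"
    "\<And>S x. finite S \<Longrightarrow> S0 \<subseteq> S \<Longrightarrow> x \<in> {a..b} \<Longrightarrow>
      \<bar>(\<Sum>(j, k)\<in>S. c j k * e j k x) - expansion 0 x\<bar> \<le> \<epsilon>"
proof -
  define s where "s j = M * 2 powr (- (real j * (r - real 0)))" for j
  have r0: "real 0 < r" using r_pos by simp
  have s: "summable s" unfolding s_def by (rule level_bound_summable[OF r0])
  from suminf_exist_split[OF assms s] obtain J where J: "norm (\<Sum>j. s (j + J)) < \<epsilon>" by blast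
  let ?S0 = "SIGMA j:{..<J}. {k. supp (e j k) \<inter> {a..b} \<noteq> {}}"
  show ?thesis
  proof (rule that[of ?S0])
    show "finite ?S0" using locally_finite by auto
    fix S x assume S: "finite S" "?S0 \<subseteq> S" and x: "x \<in> {a..b}"
    define T where "T j = {k. (j, k) \<in> S}" for j
    define d where "d j = level j 0 x - (\<Sum>k\<in>T j. c j k * e j k x)" for j
    have finT: "finite (T j)" for j
      by (rule finite_subset[of _ "snd ` S"]) (force simp: T_def S(1))+
    have "S = (SIGMA j:fst ` S. T j)" by (force simp: T_def)
    then have "(\<Sum>(j, k)\<in>S. c j k * e j k x) = (\<Sum>j\<in>fst ` S. \<Sum>k\<in>T j. c j k * e j k x)"
      using sum.Sigma[of "fst ` S" T "\<lambda>j k. c j k * e j k x"] S(1) finT by simp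
    moreover have "(\<lambda>j. \<Sum>k\<in>T j. c j k * e j k x) sums (\<Sum>j\<in>fst ` S. \<Sum>k\<in>T j. c j k * e j k x)"
    proof (rule sums_finite)
      fix j assume "j \<notin> fst ` S"
      then have "T j = {}" by (force simp: T_def)
      then show "(\<Sum>k\<in>T j. c j k * e j k x) = 0" by simp
    qed (use S in simp)
    ultimately have d_sums: "d sums (expansion 0 x - (\<Sum>(j, k)\<in>S. c j k * e j k x))"
      unfolding d_def expansion_def using level_summable[OF r0] by (auto intro!: sums_diff summable_sums)
    have d0: "d j = 0" if "j < J" for j
    proof -
      have "active j x \<subseteq> T j"
      proof
        fix k assume "k \<in> active j x"
        with x have "supp (e j k) \<inter> {a..b} \<noteq> {}" unfolding active_def by blast
        with that have "(j, k) \<in> ?S0" by simp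
        with S(2) show "k \<in> T j" unfolding T_def by blast
      qed
      from level_eq[OF finT this, of 0] show ?thesis by (simp add: d_def)
    qed
    have ds: "\<bar>d j\<bar> \<le> s j" for j
    proof -
      have "level j 0 x = (\<Sum>k\<in>active j x \<union> T j. c j k * e j k x)"
        using level_eq[of "active j x \<union> T j" j x 0] finite_active finT by simp
      also have "active j x \<union> T j = T j \<union> (active j x - T j)" by blast
      also have "(\<Sum>k\<in>T j \<union> (active j x - T j). c j k * e j k x)
          = (\<Sum>k\<in>T j. c j k * e j k x) + (\<Sum>k\<in>active j x - T j. c j k * e j k x)"
        by (rule sum.union_disjoint) (auto simp: finite_active finT)
      finally have "d j = (\<Sum>k\<in>active j x - T j. c j k * e j k x)" by (simp add: d_def)
      then show ?thesis
        using partial_level_bound[of "active j x - T j" 0 j x] finite_active by (simp add: s_def)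
    qed
    have "expansion 0 x - (\<Sum>(j, k)\<in>S. c j k * e j k x) = (\<Sum>j. d j)"
      using d_sums by (rule sums_unique)
    also have "\<dots> = (\<Sum>j. d (j + J)) + (\<Sum>j<J. d j)"
      by (rule suminf_split_initial_segment) (use d_sums sums_summable in blast)
    also have "\<dots> = (\<Sum>j. d (j + J))" using d0 by simp
    finally have "\<bar>expansion 0 x - (\<Sum>(j, k)\<in>S. c j k * e j k x)\<bar> \<le> (\<Sum>j. s (j + J))"
      using norm_suminf_le[of "\<lambda>j. d (j + J)" "\<lambda>j. s (j + J)"] ds
        summable_ignore_initial_segment[OF s, of J] by simp
    with J show "\<bar>(\<Sum>(j, k)\<in>S. c j k * e j k x) - expansion 0 x\<bar> \<le> \<epsilon>" by (simp add: abs_minus_commute)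
  qed
qed

end

section \<open>Wavelet coefficients\<close>

lemma compactly_supported_integral:
  fixes g :: "real \<Rightarrow> real"
  assumes cont: "continuous_on UNIV g" and supp: "\<And>x. x \<notin> {a..a + d} \<Longrightarrow> g x = 0"
    and le: "\<And>x. \<bar>g x\<bar> \<le> E" and d: "0 \<le> d"
  shows "integrable lborel g" "\<bar>LINT x|lborel. g x\<bar> \<le> E * d"
proof -
  have "(\<lambda>x. indicator {a..a + d} x *\<^sub>R g x) = g"
    using supp by (auto simp: indicator_def fun_eq_iff)
  with borel_integrable_compact[of "{a..a + d}" g] show int: "integrable lborel g"
    using continuous_on_subset[OF cont] by auto
  have "\<bar>LINT x|lborel. g x\<bar> \<le> (LINT x|lborel. \<bar>g x\<bar>)"
    using integral_norm_bound[of lborel g] by simp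
  also have "\<dots> \<le> (LINT x|lborel. E * indicator {a..a + d} x)"
  proof (rule integral_mono)
    show "\<bar>g x\<bar> \<le> E * indicator {a..a + d} x" for x
      using le[of x] supp[of x] by (cases "x \<in> {a..a + d}") auto
    show "integrable lborel (\<lambda>x. E * indicator {a..a + d} x)"
      by (intro integrable_mult_right integrable_real_indicator) (auto simp: emeasure_lborel_Icc_eq)
  qed (use int in auto)
  also have "\<dots> = E * d" using d by simp
  finally show "\<bar>LINT x|lborel. g x\<bar> \<le> E * d" .
qed

text \<open>The moments annihilate the polynomial that approximates \<open>f\<close> on the support of \<open>w\<close>, so \<open>f\<close>
  may be replaced by the error of approximation.\<close>

lemma wavelet_coefficient_bound:
  assumes f: "continuous_on UNIV f" "locally_polynomial v r M f" and M: "0 \<le> M"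
    and w: "continuous_on UNIV w" "\<And>x. \<bar>w x\<bar> \<le> W" "supp w \<subseteq> {a..a + d}" and d: "0 < d"
    and moments: "\<And>n. n < v \<Longrightarrow> has_bochner_integral lborel (\<lambda>x. x ^ n * w x) 0"
  shows "\<bar>L2_inner f w\<bar> \<le> M * d powr r * W * d"
proof -
  obtain c where c: "\<And>x. x \<in> {a..a + d} \<Longrightarrow> \<bar>f x - (\<Sum>i<v. c i * x ^ i)\<bar> \<le> M * d powr r"
    using f(2) d unfolding locally_polynomial_def by blast
  define Q where "Q x = (\<Sum>i<v. c i * x ^ i)" for x
  have contQ: "continuous_on UNIV Q" unfolding Q_def by (intro continuous_intros)
  have off: "w x = 0" if "x \<notin> {a..a + d}" for x using that w(3) zero_off_supp by blast
  have W: "0 \<le> W" using w(2)[of 0] by linarith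
  have bound: "\<bar>(f x - Q x) * w x\<bar> \<le> M * d powr r * W" for x
  proof (cases "x \<in> {a..a + d}")
    case True
    then show ?thesis unfolding abs_mult Q_def by (intro mult_mono c w(2)) (use M in auto)
  next
    case False
    then show ?thesis using off M W by simp
  qed
  have cont: "continuous_on UNIV (\<lambda>x. (f x - Q x) * w x)"
    by (intro continuous_intros f(1) contQ w(1))
  have off': "(f x - Q x) * w x = 0" if "x \<notin> {a..a + d}" for x using off[OF that] by simp
  note R = compactly_supported_integral[OF cont off' bound less_imp_le[OF d]]
  have "has_bochner_integral lborel (\<lambda>x. \<Sum>i<v. c i * (x ^ i * w x)) (\<Sum>i<v. c i * 0)"
    by (intro has_bochner_integral_sum has_bochner_integral_mult_right moments) auto
  then have "has_bochner_integral lborel (\<lambda>x. Q x * w x) 0"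
    by (simp add: Q_def sum_distrib_right mult.assoc)
  from has_bochner_integral_add[OF has_bochner_integral_integrable[OF R(1)] this]
  have "L2_inner f w = (LINT x|lborel. (f x - Q x) * w x)"
    unfolding L2_inner_def by (simp add: has_bochner_integral_iff algebra_simps)
  with R(2) show ?thesis by simp
qed

section \<open>The system indexed by level\<close>

text \<open>With \<open>\<phi>\<close> as level \<open>0\<close> every bound on the system and on the coefficients takes the same form
  on all levels, since the powers of \<open>2\<close> are \<open>1\<close> for \<open>j = 0\<close>.\<close>

definition by_level :: "(int \<Rightarrow> 'a) \<Rightarrow> (nat \<Rightarrow> int \<Rightarrow> 'a) \<Rightarrow> nat \<Rightarrow> int \<Rightarrow> 'a" where
  "by_level p q j k = (if j = 0 then p k else q j k)"

definition level_index :: "int + nat \<times> int \<Rightarrow> nat \<times> int" where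
  "level_index = case_sum (\<lambda>k. (0, k)) (\<lambda>p. p)"

lemma bij_level_index: "bij_betw level_index wavelet_index UNIV"
proof -
  have "inj_on level_index wavelet_index"
    by (auto simp: inj_on_def level_index_def wavelet_index_def)
  moreover have "p \<in> level_index ` wavelet_index" for p
  proof (cases "fst p = 0")
    case True
    then have "p = level_index (Inl (snd p))" by (simp add: level_index_def prod_eq_iff)
    then show ?thesis by (auto simp: wavelet_index_def)
  next
    case False
    then have "p = level_index (Inr p)" "Inr p \<in> wavelet_index"
      by (auto simp: level_index_def wavelet_index_def mem_Times_iff)
    then show ?thesis by blast
  qed
  ultimately show ?thesis by (auto simp: bij_betw_def)
qed

lemma wavelet_family_by_level:
  "i \<in> wavelet_index \<Longrightarrow> wavelet_family p q i = case_prod (by_level p q) (level_index i)"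
  by (auto simp: wavelet_index_def wavelet_family_def level_index_def by_level_def)

lemma admissible_coeffs_iff:
  fixes r :: real and a :: "int \<Rightarrow> real" and b :: "nat \<Rightarrow> int \<Rightarrow> real"
  shows "admissible_coeffs r a b \<longleftrightarrow>
     (\<exists>B\<ge>0. \<forall>j k. \<bar>by_level a b j k\<bar> \<le> B * 2 powr (- (real j * (r + 1/2))))"
proof
  assume "admissible_coeffs r a b"
  then obtain A1 A2 where A: "0 \<le> A1" "(SUP k. ennreal \<bar>a k\<bar>) = ennreal A1" "0 \<le> A2"
    "(SUP j\<in>{1..}. ennreal (2 powr (real j * (r + 1/2))) * (SUP k. ennreal \<bar>b j k\<bar>)) = ennreal A2"
    by (auto simp: admissible_coeffs_def less_top_ennreal)
  have "\<bar>by_level a b j k\<bar> \<le> (A1 + A2) * 2 powr (- (real j * (r + 1/2)))" for j k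
  proof (cases "j = 0")
    case True
    have "ennreal \<bar>a k\<bar> \<le> ennreal A1" unfolding A(2)[symmetric] by (rule SUP_upper) simp
    with True A show ?thesis by (simp add: by_level_def)
  next
    case False
    let ?p = "2 powr (real j * (r + 1/2)) :: real"
    have "ennreal (?p * \<bar>b j k\<bar>) = ennreal ?p * ennreal \<bar>b j k\<bar>" by (simp add: ennreal_mult)
    also have "\<dots> \<le> ennreal ?p * (SUP k. ennreal \<bar>b j k\<bar>)"
      by (intro mult_left_mono SUP_upper) auto
    also have "\<dots> \<le> ennreal A2" unfolding A(4)[symmetric]
      by (rule SUP_upper[where f = "\<lambda>j. ennreal (2 powr (real j * (r + 1/2))) * (SUP k. ennreal \<bar>b j k\<bar>)"])
        (use False in simp)
    finally have "?p * \<bar>b j k\<bar> \<le> A2" using A(3) by simp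
    then have "\<bar>b j k\<bar> \<le> A2 / ?p" by (simp add: field_simps)
    also have "\<dots> \<le> (A1 + A2) / ?p" using A by (intro divide_right_mono) auto
    also have "(A1 + A2) / ?p = (A1 + A2) * 2 powr (- (real j * (r + 1/2)))"
      by (simp only: powr_minus divide_inverse)
    finally show ?thesis using False by (simp only: by_level_def if_False)
  qed
  with A show "\<exists>B\<ge>0. \<forall>j k. \<bar>by_level a b j k\<bar> \<le> B * 2 powr (- (real j * (r + 1/2)))"
    by (intro exI[of _ "A1 + A2"]) auto
next
  assume "\<exists>B\<ge>0. \<forall>j k. \<bar>by_level a b j k\<bar> \<le> B * 2 powr (- (real j * (r + 1/2)))"
  then obtain B where B: "0 \<le> B" "\<And>j k. \<bar>by_level a b j k\<bar> \<le> B * 2 powr (- (real j * (r + 1/2)))"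
    by blast
  have cancel: "2 powr t * (B * 2 powr (- t)) = B" for t :: real
    by (simp add: powr_minus)
  have "(SUP k. ennreal \<bar>a k\<bar>) \<le> ennreal B"
    using B(2)[of 0] by (intro SUP_least ennreal_leI) (simp add: by_level_def)
  moreover have "(SUP j\<in>{1..}. ennreal (2 powr (real j * (r + 1/2))) * (SUP k. ennreal \<bar>b j k\<bar>)) \<le> ennreal B"
  proof (rule SUP_least)
    fix j :: nat assume j: "j \<in> {1..}"
    let ?p = "2 powr (real j * (r + 1/2)) :: real"
    have "(SUP k. ennreal \<bar>b j k\<bar>) \<le> ennreal (B * 2 powr (- (real j * (r + 1/2))))"
      using B(2)[of j] j by (intro SUP_least ennreal_leI) (simp add: by_level_def)
    then have "ennreal ?p * (SUP k. ennreal \<bar>b j k\<bar>) \<le> ennreal ?p * ennreal (B * 2 powr (- (real j * (r + 1/2))))"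
      by (rule mult_left_mono) simp
    also have "\<dots> = ennreal (?p * (B * 2 powr (- (real j * (r + 1/2)))))"
      using B by (simp add: ennreal_mult)
    also have "?p * (B * 2 powr (- (real j * (r + 1/2)))) = B"
      by (rule cancel)
    finally show "ennreal ?p * (SUP k. ennreal \<bar>b j k\<bar>) \<le> ennreal B" .
  qed
  ultimately show "admissible_coeffs r a b"
    unfolding admissible_coeffs_def infinity_ennreal_def
    by (blast intro: le_less_trans[OF _ ennreal_less_top])
qed

text \<open>Doubling the constant leaves room to choose an interval whose length exceeds the infimum in
  the definition of the support length.\<close>

lemma by_level_supp_interval:
  assumes "compactly_supported_system \<phi> \<psi>"
  shows "\<exists>D>0. \<forall>j k. \<exists>a. supp (by_level \<phi> \<psi> j k) \<subseteq> {a..a + D * 2 powr (- real j)}"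
proof -
  obtain C where C: "0 < C" "(SUP k. supp_length (\<phi> k)) \<le> ennreal C"
      "\<forall>j\<ge>1. (SUP k. supp_length (\<psi> j k)) \<le> ennreal (C * 2 powr (- real j))"
    using assms unfolding compactly_supported_system_def by blast
  have "\<exists>a. supp (by_level \<phi> \<psi> j k) \<subseteq> {a..a + 2 * C * 2 powr (- real j)}" for j k
  proof -
    have "supp_length (by_level \<phi> \<psi> j k) \<le> ennreal (C * 2 powr (- real j))"
    proof (cases "j = 0")
      case True
      then show ?thesis using C(2) by (simp add: by_level_def SUP_le_iff)
    next
      case False
      then show ?thesis using C(3)[rule_format, of j] by (simp add: by_level_def SUP_le_iff)
    qed
    also have "\<dots> < ennreal (2 * C * 2 powr (- real j))"
      using C(1) by (intro ennreal_lessI) auto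
    finally obtain a b where "a \<le> b" "supp (by_level \<phi> \<psi> j k) \<subseteq> {a..b}"
        "ennreal (b - a) < ennreal (2 * C * 2 powr (- real j))"
      unfolding supp_length_def INF_less_iff by auto
    then have "supp (by_level \<phi> \<psi> j k) \<subseteq> {a..a + 2 * C * 2 powr (- real j)}"
      by (auto simp: ennreal_less_iff)
    then show ?thesis by blast
  qed
  with C(1) show ?thesis by (intro exI[of _ "2 * C"]) auto
qed

lemma \<Gamma>set_by_level: "\<Gamma>set \<phi> \<psi> j K = {k. supp (by_level \<phi> \<psi> j k) \<inter> K \<noteq> {}}"
  by (simp add: \<Gamma>set_def by_level_def[abs_def])

lemma by_level_locally_finite:
  assumes "locally_finite_system \<phi> \<psi>"
  shows "finite {k. supp (by_level \<phi> \<psi> j k) \<inter> {a..b} \<noteq> {}}"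
  using assms unfolding locally_finite_system_def \<Gamma>set_by_level
  by (meson bounded_closed_interval is_interval_cc)

text \<open>Apply the counting bound to a single point, whose measure is \<open>0\<close>.\<close>

lemma by_level_overlap:
  assumes "locally_finite_system \<phi> \<psi>"
  shows "\<exists>N. \<forall>j x. card {k. x \<in> supp (by_level \<phi> \<psi> j k)} \<le> N"
proof -
  obtain C where C: "\<And>K j. is_interval K \<Longrightarrow> bounded K \<Longrightarrow>
      real (card (\<Gamma>set \<phi> \<psi> j K)) \<le> C * (2 ^ j * measure lborel K + 1)"
    using assms unfolding locally_finite_system_def by blast
  have "card {k. x \<in> supp (by_level \<phi> \<psi> j k)} \<le> nat \<lceil>C\<rceil>" for j x
    using C[of "{x..x}" j, OF is_interval_cc bounded_closed_interval] by (simp add: \<Gamma>set_by_level) linarith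
  then show ?thesis by blast
qed

lemma by_level_C_norm:
  assumes "smooth_system s \<phi> \<psi>" "0 \<le> t" "t \<le> s"
  shows "\<exists>A>0. \<forall>j k. C_norm t (by_level \<phi> \<psi> j k) \<le> ennreal (A * 2 powr (real j * (t + 1/2)))"
proof -
  obtain A where A: "0 < A" "(SUP k. C_norm t (\<phi> k)) \<le> ennreal A"
      "\<forall>j\<ge>1. (SUP k. C_norm t (\<psi> j k)) \<le> ennreal (A * 2 powr (real j * (t + 1/2)))"
    using assms unfolding smooth_system_def by (meson atLeastAtMost_iff)
  have "C_norm t (by_level \<phi> \<psi> j k) \<le> ennreal (A * 2 powr (real j * (t + 1/2)))" for j k
  proof (cases "j = 0")
    case True
    then show ?thesis using A(2) by (simp add: by_level_def SUP_le_iff)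
  next
    case False
    then show ?thesis using A(3)[rule_format, of j] by (simp add: by_level_def SUP_le_iff)
  qed
  with A(1) show ?thesis by blast
qed

lemma C_nat_mono:
  assumes "f \<in> C_nat n" "m \<le> n"
  shows "f \<in> C_nat m"
  using assms(1) C_nat_D(2)[OF assms] assms(2) by (auto simp: C_nat_def)

lemma by_level_C_nat:
  assumes "smooth_system s \<phi> \<psi>" "m \<le> nat \<lfloor>s\<rfloor>"
  shows "by_level \<phi> \<psi> j k \<in> C_nat m"
proof -
  have "by_level \<phi> \<psi> j k \<in> C_space s"
    using assms(1) by (auto simp: smooth_system_def by_level_def)
  then show ?thesis using C_nat_mono[OF _ assms(2)] C_space_subset_C_nat by blast
qed

lemma by_level_deriv_bound:
  assumes "smooth_system s \<phi> \<psi>" "real i \<le> s"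
  shows "\<exists>A>0. \<forall>j k x. \<bar>(deriv ^^ i) (by_level \<phi> \<psi> j k) x\<bar> \<le> A * 2 powr (real j * (real i + 1/2))"
proof -
  obtain A where A: "0 < A"
      "\<And>j k. C_norm (real i) (by_level \<phi> \<psi> j k) \<le> ennreal (A * 2 powr (real j * (real i + 1/2)))"
    using by_level_C_norm[OF assms(1) _ assms(2)] by auto
  have "i \<le> nat \<lfloor>s\<rfloor>" using assms(2) by linarith
  then have "by_level \<phi> \<psi> j k \<in> C_nat (nat \<lfloor>real i\<rfloor>)" for j k
    using by_level_C_nat[OF assms(1)] by simp
  from C_norm_deriv_bound[OF this A(2)] A(1) show ?thesis by (intro exI[of _ A]) auto
qed

text \<open>If \<open>s \<ge> l + 1\<close>, the derivative of order \<open>l + 1\<close> is bounded and \<open>\<beta> = 1\<close> works.  Otherwise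
  \<open>l < s < l + 1\<close>, and the \<open>C\<^sup>s\<close> norm itself gives the exponent \<open>\<beta> = s - l > r - l\<close>.\<close>

lemma by_level_holder_bound:
  assumes "smooth_system s \<phi> \<psi>" "real l \<le> r" "r < real l + 1" "r < s"
  shows "\<exists>\<beta> A. r - real l < \<beta> \<and> 0 < A \<and>
    (\<forall>j k x y. \<bar>(deriv ^^ l) (by_level \<phi> \<psi> j k) x - (deriv ^^ l) (by_level \<phi> \<psi> j k) y\<bar>
       \<le> A * 2 powr (real j * (real l + \<beta> + 1/2)) * \<bar>x - y\<bar> powr \<beta>)"
proof (cases "real (Suc l) \<le> s")
  case True
  then obtain A where A: "0 < A"
      "\<And>j k x. \<bar>(deriv ^^ Suc l) (by_level \<phi> \<psi> j k) x\<bar> \<le> A * 2 powr (real j * (real (Suc l) + 1/2))"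
    using by_level_deriv_bound[OF assms(1)] by blast
  have "Suc l \<le> nat \<lfloor>s\<rfloor>" using True by linarith
  note C = by_level_C_nat[OF assms(1) this]
  have "\<bar>(deriv ^^ l) (by_level \<phi> \<psi> j k) x - (deriv ^^ l) (by_level \<phi> \<psi> j k) y\<bar>
       \<le> A * 2 powr (real j * (real l + 1 + 1/2)) * \<bar>x - y\<bar> powr 1" for j k x y
    using field_differentiable_bound[of UNIV "(deriv ^^ l) (by_level \<phi> \<psi> j k)"
        "(deriv ^^ Suc l) (by_level \<phi> \<psi> j k)" "A * 2 powr (real j * (real l + 1 + 1/2))" y x]
      C_nat_D(1)[OF C, of l] A(2) by (simp add: abs_minus_commute add.commute)
  then show ?thesis using A(1) assms(3) by (intro exI[of _ 1] exI[of _ A]) auto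
next
  case False
  have fl: "nat \<lfloor>s\<rfloor> = l" using False assms by linarith
  have "\<lfloor>s\<rfloor> = int l" by (rule floor_unique) (use False assms in auto)
  then have fr: "frac s = s - real l" by (simp add: frac_def)
  have "s \<notin> \<nat>"
  proof
    assume "s \<in> \<nat>"
    then obtain n where n: "s = real n" by (auto elim: Nats_cases)
    with assms have "real l < real n" by linarith
    with False n show False by simp
  qed
  obtain A where A: "0 < A"
      "\<And>j k. C_norm s (by_level \<phi> \<psi> j k) \<le> ennreal (A * 2 powr (real j * (s + 1/2)))"
    using by_level_C_norm[OF assms(1), of s] assms by auto
  have "\<bar>(deriv ^^ l) (by_level \<phi> \<psi> j k) x - (deriv ^^ l) (by_level \<phi> \<psi> j k) y\<bar>
       \<le> A * 2 powr (real j * (real l + frac s + 1/2)) * \<bar>x - y\<bar> powr frac s" for j k x y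
    using C_norm_holder_bound[OF A(2) _ \<open>s \<notin> \<nat>\<close>] A(1) unfolding fl by (simp add: fr)
  then show ?thesis using A(1) assms(4) fr by (intro exI[of _ "frac s"] exI[of _ A]) auto
qed

lemma wavelet_expansion_by_level:
  assumes "smooth_system s \<phi> \<psi>" "locally_finite_system \<phi> \<psi>" "0 < r" "r < s"
    and "admissible_coeffs r a b"
  shows "\<exists>\<beta> A B l N. wavelet_expansion (by_level \<phi> \<psi>) (by_level a b) r \<beta> A B l N"
proof -
  define l where "l = nat \<lfloor>r\<rfloor>"
  have l: "real l \<le> r" "r < real l + 1" using assms(3) unfolding l_def by linarith+
  obtain \<beta> A' where \<beta>: "r - real l < \<beta>" "0 < A'"
    "\<And>j k x y. \<bar>(deriv ^^ l) (by_level \<phi> \<psi> j k) x - (deriv ^^ l) (by_level \<phi> \<psi> j k) y\<bar>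
       \<le> A' * 2 powr (real j * (real l + \<beta> + 1/2)) * \<bar>x - y\<bar> powr \<beta>"
    using by_level_holder_bound[OF assms(1) l assms(4)] by blast
  have "\<forall>i\<in>{..l}. \<exists>A>0. \<forall>j k x. \<bar>(deriv ^^ i) (by_level \<phi> \<psi> j k) x\<bar> \<le> A * 2 powr (real j * (real i + 1/2))"
    using by_level_deriv_bound[OF assms(1)] l assms(4) by auto
  from bchoice[OF this] obtain F where "\<forall>i\<in>{..l}. 0 < F i \<and> (\<forall>j k x.
      \<bar>(deriv ^^ i) (by_level \<phi> \<psi> j k) x\<bar> \<le> F i * 2 powr (real j * (real i + 1/2)))" by blast
  then have F: "0 < F i" "\<bar>(deriv ^^ i) (by_level \<phi> \<psi> j k) x\<bar> \<le> F i * 2 powr (real j * (real i + 1/2))"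
    if "i \<le> l" for i j k x
    using that by blast+
  define A where "A = A' + (\<Sum>i\<le>l. F i)"
  have FA: "F i \<le> A" if "i \<le> l" for i
  proof -
    have "F i \<le> (\<Sum>i\<le>l. F i)"
      by (rule member_le_sum) (use that less_imp_le[OF F(1)] in auto)
    with \<beta>(2) show ?thesis by (simp add: A_def)
  qed
  have A'A: "A' \<le> A" using sum_nonneg[of "{..l}" F] less_imp_le[OF F(1)] by (simp add: A_def)
  obtain B where B: "0 \<le> B" "\<And>j k. \<bar>by_level a b j k\<bar> \<le> B * 2 powr (- (real j * (r + 1/2)))"
    using assms(5) unfolding admissible_coeffs_iff by blast
  obtain N where N: "\<And>j x. card {k. x \<in> supp (by_level \<phi> \<psi> j k)} \<le> N"
    using by_level_overlap[OF assms(2)] by blast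
  have "wavelet_expansion (by_level \<phi> \<psi>) (by_level a b) r \<beta> A B l N"
  proof
    show "0 \<le> A" using A'A \<beta>(2) by simp
    show "by_level \<phi> \<psi> j k \<in> C_nat l" for j k
      by (rule by_level_C_nat[OF assms(1)]) (use l assms(4) in linarith)
    show "\<bar>(deriv ^^ i) (by_level \<phi> \<psi> j k) x\<bar> \<le> A * 2 powr (real j * (real i + 1/2))"
      if "i \<le> l" for j k i x
      using order_trans[OF F(2)[OF that] mult_right_mono[OF FA[OF that]]] by simp
    show "\<bar>(deriv ^^ l) (by_level \<phi> \<psi> j k) x - (deriv ^^ l) (by_level \<phi> \<psi> j k) y\<bar>
       \<le> A * 2 powr (real j * (real l + \<beta> + 1/2)) * \<bar>x - y\<bar> powr \<beta>" for j k x y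
      by (rule order_trans[OF \<beta>(3)]) (intro mult_right_mono A'A; simp)
  qed (use assms l \<beta> B N by_level_locally_finite in auto)
  then show ?thesis by blast
qed

section \<open>Unordered series in local square mean\<close>

lemma L2loc_has_sum_if_locally_uniform:
  assumes u: "\<And>i. i \<in> I \<Longrightarrow> continuous_on UNIV (u i)" and f: "continuous_on UNIV f"
    and uniform: "\<And>R \<epsilon>. 0 < \<epsilon> \<Longrightarrow> \<exists>S0. finite S0 \<and> S0 \<subseteq> I \<and>
      (\<forall>S x. finite S \<and> S0 \<subseteq> S \<and> S \<subseteq> I \<and> x \<in> {- R..R} \<longrightarrow> \<bar>(\<Sum>i\<in>S. u i x) - f x\<bar> \<le> \<epsilon>)"
  shows "L2loc_has_sum u I f"
  unfolding L2loc_has_sum_def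
proof (intro allI impI)
  fix K :: "real set" assume K: "compact K"
  then obtain R where R: "0 < R" "K \<subseteq> {- R..R}"
    using bounded_pos[of K] compact_imp_bounded by (auto simp: subset_eq abs_le_iff minus_le_iff)
  have L2: "g \<in> L2_on K" if "continuous_on UNIV g" for g
    unfolding L2_on_def set_integrable_def
    using that K borel_integrable_compact[of K "\<lambda>x. (g x)\<^sup>2"]
    by (auto intro!: borel_measurable_continuous_onI continuous_intros continuous_on_subset[OF that])
  have "((\<lambda>S. \<integral>\<^sup>+x\<in>K. ennreal (((\<Sum>i\<in>S. u i x) - f x)\<^sup>2) \<partial>lborel) \<longlongrightarrow> 0) (finite_subsets_at_top I)"
  proof (rule order_tendstoI)
    fix \<delta>' :: ennreal assume "0 < \<delta>'"
    then obtain z where z: "0 < z" "z < \<delta>'" using dense by blast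
    then obtain \<delta> where \<delta>: "z = ennreal \<delta>" "0 < \<delta>"
      by (cases z) auto
    \<comment> \<open>The integral over \<open>K\<close> is at most \<open>\<epsilon>\<^sup>2\<close> times the length \<open>2 R\<close>.\<close>
    define \<epsilon> where "\<epsilon> = sqrt (\<delta> / (2 * R))"
    have \<epsilon>: "0 < \<epsilon>" "\<epsilon>\<^sup>2 * (2 * R) = \<delta>" using R(1) \<delta>(2) by (auto simp: \<epsilon>_def)
    obtain S0 where S0: "finite S0" "S0 \<subseteq> I" "\<forall>S x. finite S \<and> S0 \<subseteq> S \<and> S \<subseteq> I \<and> x \<in> {- R..R} \<longrightarrow>
        \<bar>(\<Sum>i\<in>S. u i x) - f x\<bar> \<le> \<epsilon>"
      using uniform[OF \<epsilon>(1), of R] by (elim exE conjE)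
    have "(\<integral>\<^sup>+x\<in>K. ennreal (((\<Sum>i\<in>S. u i x) - f x)\<^sup>2) \<partial>lborel) < \<delta>'"
      if S: "finite S" "S0 \<subseteq> S" "S \<subseteq> I" for S
    proof -
      have "ennreal (((\<Sum>i\<in>S. u i x) - f x)\<^sup>2) * indicator K x \<le> ennreal (\<epsilon>\<^sup>2) * indicator {- R..R} x" for x
      proof (cases "x \<in> K")
        case True
        then have x: "x \<in> {- R..R}" using R(2) by blast
        have "\<bar>(\<Sum>i\<in>S. u i x) - f x\<bar> \<le> \<bar>\<epsilon>\<bar>" using S0(3) S x \<epsilon>(1) by simp
        then have "((\<Sum>i\<in>S. u i x) - f x)\<^sup>2 \<le> \<epsilon>\<^sup>2" by (simp only: abs_le_square_iff)
        with x show ?thesis by (auto simp: indicator_def intro: ennreal_leI)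
      qed simp
      then have "(\<integral>\<^sup>+x\<in>K. ennreal (((\<Sum>i\<in>S. u i x) - f x)\<^sup>2) \<partial>lborel)
          \<le> (\<integral>\<^sup>+x. ennreal (\<epsilon>\<^sup>2) * indicator {- R..R} x \<partial>lborel)"
        by (rule nn_integral_mono)
      also have "\<dots> = ennreal (\<epsilon>\<^sup>2) * ennreal (2 * R)"
        using R(1) by (simp add: nn_integral_cmult_indicator)
      also have "\<dots> = ennreal \<delta>" unfolding \<epsilon>(2)[symmetric] using R(1) by (simp add: ennreal_mult)
      finally show ?thesis using z \<delta> by simp
    qed
    then show "\<forall>\<^sub>F S in finite_subsets_at_top I.
        (\<integral>\<^sup>+x\<in>K. ennreal (((\<Sum>i\<in>S. u i x) - f x)\<^sup>2) \<partial>lborel) < \<delta>'"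
      unfolding eventually_finite_subsets_at_top using S0(1,2) by blast
  qed simp
  then show "L2_has_sum_on K u I f"
    unfolding L2_has_sum_on_def using L2 u f by blast
qed

text \<open>Integrate \<open>(f - g)\<^sup>2 \<le> 2 (t - f)\<^sup>2 + 2 (t - g)\<^sup>2\<close> with \<open>t\<close> a partial sum, and pass to the
  limit.\<close>

lemma L2_has_sum_on_unique:
  assumes f: "L2_has_sum_on K u I f" and g: "L2_has_sum_on K u I g" and K: "K \<in> sets lborel"
  shows "AE x in lborel. x \<in> K \<longrightarrow> f x = g x"
proof -
  let ?I = "\<lambda>S h. \<integral>\<^sup>+x\<in>K. ennreal (((\<Sum>i\<in>S. u i x) - h x)\<^sup>2) \<partial>lborel"
  have [measurable]: "f \<in> borel_measurable lborel" "g \<in> borel_measurable lborel" "K \<in> sets lborel"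
    using f g K by (auto simp: L2_has_sum_on_def L2_on_def)
  have mu: "u i \<in> borel_measurable lborel" if "i \<in> I" for i
    using f that by (auto simp: L2_has_sum_on_def L2_on_def)
  have le: "(\<integral>\<^sup>+x\<in>K. ennreal ((f x - g x)\<^sup>2) \<partial>lborel) \<le> 2 * ?I S f + 2 * ?I S g"
    if S: "finite S" "S \<subseteq> I" for S
  proof -
    have [measurable]: "(\<lambda>x. \<Sum>i\<in>S. u i x) \<in> borel_measurable lborel"
      using mu S by (intro borel_measurable_sum) auto
    have "ennreal ((f x - g x)\<^sup>2) * indicator K x \<le>
        2 * (ennreal (((\<Sum>i\<in>S. u i x) - f x)\<^sup>2) * indicator K x) +
        2 * (ennreal (((\<Sum>i\<in>S. u i x) - g x)\<^sup>2) * indicator K x)" for x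
    proof (cases "x \<in> K")
      case True
      let ?t = "\<Sum>i\<in>S. u i x"
      have "(f x - g x)\<^sup>2 \<le> 2 * (?t - f x)\<^sup>2 + 2 * (?t - g x)\<^sup>2"
        using zero_le_power2[of "2 * ?t - f x - g x"] by (simp add: power2_eq_square algebra_simps)
      then have "ennreal ((f x - g x)\<^sup>2) \<le> ennreal (2 * (?t - f x)\<^sup>2 + 2 * (?t - g x)\<^sup>2)"
        by (rule ennreal_leI)
      also have "\<dots> = 2 * ennreal ((?t - f x)\<^sup>2) + 2 * ennreal ((?t - g x)\<^sup>2)"
        by (simp add: ennreal_mult)
      finally show ?thesis using True by simp
    qed simp
    then have "(\<integral>\<^sup>+x\<in>K. ennreal ((f x - g x)\<^sup>2) \<partial>lborel) \<le>
        (\<integral>\<^sup>+x. 2 * (ennreal (((\<Sum>i\<in>S. u i x) - f x)\<^sup>2) * indicator K x) +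
        2 * (ennreal (((\<Sum>i\<in>S. u i x) - g x)\<^sup>2) * indicator K x) \<partial>lborel)"
      by (rule nn_integral_mono)
    also have "\<dots> = 2 * ?I S f + 2 * ?I S g"
      by (subst nn_integral_add) (auto simp: nn_integral_cmult)
    finally show ?thesis .
  qed
  have "((\<lambda>S. 2 * ?I S f + 2 * ?I S g) \<longlongrightarrow> 2 * 0 + 2 * 0) (finite_subsets_at_top I)"
    using f g unfolding L2_has_sum_on_def
    by (intro tendsto_add ennreal_tendsto_cmult) auto
  then have "((\<lambda>S. 2 * ?I S f + 2 * ?I S g) \<longlongrightarrow> 0) (finite_subsets_at_top I)" by simp
  then have "(\<integral>\<^sup>+x\<in>K. ennreal ((f x - g x)\<^sup>2) \<partial>lborel) \<le> 0"
    by (rule tendsto_lowerbound)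
      (auto intro!: eventually_finite_subsets_at_top_weakI le)
  then have "(\<integral>\<^sup>+x. ennreal ((f x - g x)\<^sup>2) * indicator K x \<partial>lborel) = 0" by simp
  then have "AE x in lborel. ennreal ((f x - g x)\<^sup>2) * indicator K x = 0"
    by (subst (asm) nn_integral_0_iff_AE) auto
  then show ?thesis by eventually_elim (auto simp: indicator_def)
qed

lemma L2loc_has_sum_unique:
  assumes "L2loc_has_sum u I f" "L2loc_has_sum u I g"
  shows "AE x in lborel. f x = g x"
proof -
  have "AE x in lborel. x \<in> {- real n..real n} \<longrightarrow> f x = g x" for n
    using assms by (intro L2_has_sum_on_unique) (auto simp: L2loc_has_sum_def)
  then have "AE x in lborel. \<forall>n::nat. x \<in> {- real n..real n} \<longrightarrow> f x = g x"
    by (simp only: AE_all_countable) blast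
  then show ?thesis
  proof eventually_elim
    case (elim x)
    obtain n :: nat where "\<bar>x\<bar> \<le> real n" using real_arch_simple by blast
    then have "x \<in> {- real n..real n}" by auto
    with elim show ?case by blast
  qed
qed

lemma ae_class_cong:
  assumes "AE x in lborel. f x = g x"
  shows "ae_class f = ae_class g"
proof -
  have "(AE x in lborel. h x = f x) \<longleftrightarrow> (AE x in lborel. h x = g x)" for h
    using assms by (auto elim: eventually_elim2)
  then show ?thesis by (simp add: ae_class_def)
qed

text \<open>A continuous function need not be square integrable, so the frame expansion does not apply to
  \<open>f\<close> itself.  Cut \<open>f\<close> off to a neighbourhood \<open>J\<close> of \<open>K\<close> that is wide enough to contain the
  support of every \<open>e i\<close> that meets \<open>K\<close>.  These \<open>e i\<close> have the same coefficients for \<open>f\<close> as for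
  the truncation, and all others vanish on \<open>K\<close>: on \<open>K\<close> the partial sums of the two series
  agree.\<close>

lemma parseval_frame_L2loc:
  assumes frame: "parseval_frame e I"
    and supp: "\<And>i. i \<in> I \<Longrightarrow> \<exists>a. supp (e i) \<subseteq> {a..a + D}"
    and f: "continuous_on UNIV f"
  shows "L2loc_has_sum (\<lambda>i x. L2_inner f (e i) * e i x) I f"
  unfolding L2loc_has_sum_def
proof (intro allI impI)
  fix K :: "real set" assume K: "compact K"
  then obtain R where R: "0 < R" "K \<subseteq> {- R..R}"
    using bounded_pos[of K] compact_imp_bounded by (auto simp: subset_eq abs_le_iff minus_le_iff)
  let ?J = "{- R - \<bar>D\<bar>..R + \<bar>D\<bar>}"
  define g where "g x = indicator ?J x * f x" for x
  have fm: "f \<in> borel_measurable lborel" using f by (simp add: borel_measurable_continuous_onI)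
  have "integrable lborel (\<lambda>x. indicator ?J x *\<^sub>R (f x)\<^sup>2)"
    by (rule borel_integrable_compact)
      (auto intro!: continuous_intros continuous_on_subset[OF f])
  moreover have "(\<lambda>x. indicator ?J x *\<^sub>R (f x)\<^sup>2) = (\<lambda>x. (g x)\<^sup>2)"
    by (auto simp: g_def indicator_def fun_eq_iff)
  moreover have "g \<in> borel_measurable lborel" unfolding g_def using fm by measurable
  ultimately have "g \<in> L2_on UNIV" by (simp add: L2_on_def set_integrable_def)
  then have sum_g: "L2_has_sum_on UNIV (\<lambda>i x. L2_inner g (e i) * e i x) I g"
    using frame by (simp add: parseval_frame_def)
  have gf: "g x = f x" if "x \<in> K" for x
    using that R(2) by (auto simp: g_def indicator_def subset_eq)
  have coeff: "L2_inner g (e i) * e i x = L2_inner f (e i) * e i x" if "i \<in> I" "x \<in> K" for i x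
  proof (cases "e i x = 0")
    case False
    obtain a where a: "supp (e i) \<subseteq> {a..a + D}" using supp \<open>i \<in> I\<close> by blast
    have "x \<in> supp (e i)" using False zero_off_supp by blast
    with a have "x \<in> {a..a + D}" by blast
    moreover have "x \<in> {- R..R}" using that R by blast
    ultimately have "supp (e i) \<subseteq> ?J" using a by (intro order_trans[OF a]) auto
    then have "e i y = 0" if "y \<notin> ?J" for y
      using that zero_off_supp[of y "e i"] by blast
    then have "g y * e i y = f y * e i y" for y
      by (auto simp: g_def indicator_def simp del: atLeastAtMost_iff)
    then show ?thesis by (simp only: L2_inner_def)
  qed simp
  have L2_restrict: "h \<in> L2_on K" if "h \<in> L2_on UNIV" for h
    using that set_integrable_subset[of lborel UNIV "\<lambda>x. (h x)\<^sup>2" K] borel_compact[OF K]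
    by (auto simp: L2_on_def)
  have "f \<in> L2_on K"
    unfolding L2_on_def set_integrable_def
    using fm K borel_integrable_compact[of K "\<lambda>x. (f x)\<^sup>2"]
    by (auto intro!: continuous_intros continuous_on_subset[OF f])
  moreover have "(\<lambda>x. L2_inner f (e i) * e i x) \<in> L2_on K" if "i \<in> I" for i
  proof -
    have "e i \<in> L2_on K" using frame that L2_restrict by (auto simp: parseval_frame_def)
    then show ?thesis
      by (auto simp: L2_on_def power_mult_distrib set_integrable_def mult.left_commute[of "indicator _ _"])
  qed
  moreover have "((\<lambda>S. \<integral>\<^sup>+x\<in>K. ennreal (((\<Sum>i\<in>S. L2_inner f (e i) * e i x) - f x)\<^sup>2) \<partial>lborel) \<longlongrightarrow> 0)
      (finite_subsets_at_top I)"
  proof (rule tendsto_sandwich[OF _ _ tendsto_const])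
    show "((\<lambda>S. \<integral>\<^sup>+x\<in>UNIV. ennreal (((\<Sum>i\<in>S. L2_inner g (e i) * e i x) - g x)\<^sup>2) \<partial>lborel) \<longlongrightarrow> 0)
        (finite_subsets_at_top I)"
      using sum_g by (simp add: L2_has_sum_on_def)
    show "\<forall>\<^sub>F S in finite_subsets_at_top I.
        (\<integral>\<^sup>+x\<in>K. ennreal (((\<Sum>i\<in>S. L2_inner f (e i) * e i x) - f x)\<^sup>2) \<partial>lborel)
        \<le> (\<integral>\<^sup>+x\<in>UNIV. ennreal (((\<Sum>i\<in>S. L2_inner g (e i) * e i x) - g x)\<^sup>2) \<partial>lborel)"
    proof (rule eventually_finite_subsets_at_top_weakI, rule nn_integral_mono)
      fix S x assume S: "S \<subseteq> I"
      show "ennreal (((\<Sum>i\<in>S. L2_inner f (e i) * e i x) - f x)\<^sup>2) * indicator K x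
          \<le> ennreal (((\<Sum>i\<in>S. L2_inner g (e i) * e i x) - g x)\<^sup>2) * indicator UNIV x"
      proof (cases "x \<in> K")
        case True
        have "(\<Sum>i\<in>S. L2_inner f (e i) * e i x) = (\<Sum>i\<in>S. L2_inner g (e i) * e i x)"
          using S True by (intro sum.cong refl coeff[symmetric]) auto
        with gf[OF True] show ?thesis using True by simp
      qed simp
    qed
  qed auto
  ultimately show "L2_has_sum_on K (\<lambda>i x. L2_inner f (e i) * e i x) I f"
    by (simp add: L2_has_sum_on_def)
qed

section \<open>The characterization of Besov spaces\<close>

lemma admissible_coeffs_synthesis:
  assumes "smooth_system s \<phi> \<psi>" "locally_finite_system \<phi> \<psi>" "0 < r" "r < s"
    and "admissible_coeffs r a b"
  shows "\<exists>f\<in>besov r. wavelet_series_sum \<phi> \<psi> a b f"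
proof -
  let ?e = "by_level \<phi> \<psi>" and ?c = "by_level a b"
  obtain \<beta> A B l N where "wavelet_expansion ?e ?c r \<beta> A B l N"
    using wavelet_expansion_by_level[OF assms] by blast
  then interpret wavelet_expansion ?e ?c r \<beta> A B l N .
  note inj = bij_betw_imp_inj_on[OF bij_level_index]
  have sum_eq: "(\<Sum>i\<in>S. wavelet_family a b i * wavelet_family \<phi> \<psi> i x)
      = (\<Sum>(j, k)\<in>level_index ` S. ?c j k * ?e j k x)" if "S \<subseteq> wavelet_index" for S x
  proof -
    have "(\<Sum>(j, k)\<in>level_index ` S. ?c j k * ?e j k x)
        = (\<Sum>i\<in>S. case level_index i of (j, k) \<Rightarrow> ?c j k * ?e j k x)"
      using inj_on_subset[OF inj that] by (simp add: sum.reindex)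
    also have "\<dots> = (\<Sum>i\<in>S. wavelet_family a b i * wavelet_family \<phi> \<psi> i x)"
      using that by (intro sum.cong refl) (auto simp: wavelet_family_by_level split: prod.split)
    finally show ?thesis by simp
  qed
  have "wavelet_series_sum \<phi> \<psi> a b (expansion 0)"
    unfolding wavelet_series_sum_def
  proof (rule L2loc_has_sum_if_locally_uniform)
    show "continuous_on UNIV (expansion 0)" using expansion_continuous[of 0] r_pos by simp
    fix i assume i: "i \<in> wavelet_index"
    obtain j k where jk: "level_index i = (j, k)" by fastforce
    have "continuous_on UNIV (?e j k)" using C_nat_D(2)[OF smooth, of 0 j k] by simp
    then show "continuous_on UNIV (\<lambda>x. wavelet_family a b i * wavelet_family \<phi> \<psi> i x)"
      unfolding wavelet_family_by_level[OF i] jk by (simp add: continuous_on_mult_left)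
  next
    fix R \<epsilon> :: real assume "0 < \<epsilon>"
    then obtain S0 where S0: "finite S0" "\<And>S x. finite S \<Longrightarrow> S0 \<subseteq> S \<Longrightarrow> x \<in> {- R..R} \<Longrightarrow>
        \<bar>(\<Sum>(j, k)\<in>S. ?c j k * ?e j k x) - expansion 0 x\<bar> \<le> \<epsilon>"
      using partial_sums_uniform[of \<epsilon> "- R" R] by blast
    let ?T = "{i \<in> wavelet_index. level_index i \<in> S0}"
    have img: "level_index ` ?T = S0"
    proof
      show "S0 \<subseteq> level_index ` ?T"
      proof
        fix p assume p: "p \<in> S0"
        have "p \<in> level_index ` wavelet_index"
          using bij_betw_imp_surj_on[OF bij_level_index] by simp
        then obtain i where "i \<in> wavelet_index" "p = level_index i" by blast
        with p show "p \<in> level_index ` ?T" by blast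
      qed
    qed blast
    have "finite ?T"
      using S0(1) inj_on_subset[OF inj, of ?T] by (intro finite_imageD[where f = level_index]) (auto simp: img)
    moreover have "\<bar>(\<Sum>i\<in>S. wavelet_family a b i * wavelet_family \<phi> \<psi> i x) - expansion 0 x\<bar> \<le> \<epsilon>"
      if "finite S" "?T \<subseteq> S" "S \<subseteq> wavelet_index" "x \<in> {- R..R}" for S x
      unfolding sum_eq[OF that(3)]
    proof (rule S0(2))
      show "S0 \<subseteq> level_index ` S" using image_mono[OF that(2), of level_index] by (simp add: img)
    qed (use that in auto)
    ultimately show "\<exists>S0. finite S0 \<and> S0 \<subseteq> wavelet_index \<and>
        (\<forall>S x. finite S \<and> S0 \<subseteq> S \<and> S \<subseteq> wavelet_index \<and> x \<in> {- R..R} \<longrightarrow>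
          \<bar>(\<Sum>i\<in>S. wavelet_family a b i * wavelet_family \<phi> \<psi> i x) - expansion 0 x\<bar> \<le> \<epsilon>)"
      by (intro exI[of _ ?T]) auto
  qed
  with expansion_besov show ?thesis by blast
qed

text \<open>On level \<open>0\<close> there are no moments, but boundedness of \<open>f\<close> suffices.  On level \<open>j \<ge> 1\<close> the
  support lies in an interval whose length \<open>d\<close> is a multiple of \<open>2\<close> to the power \<open>-j\<close>, and the
  wavelet is at most of the size of \<open>2\<close> to the power \<open>j/2\<close>.  The error of approximation \<open>d\<^sup>r\<close>,
  the size of the wavelet and the length \<open>d\<close> combine to the exponent
  \<open>-j r + j/2 - j = -j (r + 1/2)\<close>.\<close>

lemma besov_analysis_coeffs:
  assumes f: "f \<in> besov r" and r: "0 < r" "r < real v" "0 < s"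
    and cs: "compactly_supported_system \<phi> \<psi>" and vm: "vanishing_moments v \<psi>"
    and sm: "smooth_system s \<phi> \<psi>"
  shows "admissible_coeffs r (\<lambda>k. L2_inner f (\<phi> k)) (\<lambda>j k. L2_inner f (\<psi> j k))"
proof -
  let ?e = "by_level \<phi> \<psi>"
  note fc = besov_continuous[OF f r(1)]
  obtain F where F: "0 \<le> F" "\<And>x. \<bar>f x\<bar> \<le> F" using besov_bounded[OF f r(1)] by blast
  obtain M where M: "0 \<le> M" "locally_polynomial v r M f"
    using besov_locally_polynomial[OF f r(1,2)] by blast
  obtain D where D: "0 < D" "\<And>j k. \<exists>a. supp (?e j k) \<subseteq> {a..a + D * 2 powr (- real j)}"
    using by_level_supp_interval[OF cs] by blast
  obtain W where W: "0 < W" "\<And>j k x. \<bar>?e j k x\<bar> \<le> W * 2 powr (real j * (1/2))"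
    using by_level_deriv_bound[OF sm, of 0] r(3) by auto
  have ec: "continuous_on UNIV (?e j k)" for j k
    using C_nat_D(2)[OF by_level_C_nat[OF sm, of 0], of 0 j k] by simp
  let ?B = "F * W * D + M * D powr r * W * D"
  have nonneg: "0 \<le> F * W * D" "0 \<le> M * D powr r * W * D" using F M D W by auto
  have "\<bar>L2_inner f (?e j k)\<bar> \<le> ?B * 2 powr (- (real j * (r + 1/2)))" for j k
  proof (cases "j = 0")
    case True
    obtain a where a: "supp (?e 0 k) \<subseteq> {a..a + D}" using D(2)[of 0 k] by auto
    have "\<bar>f x * ?e 0 k x\<bar> \<le> F * W" for x
      unfolding abs_mult using F W(2)[of 0 k x] by (intro mult_mono) auto
    moreover have "f x * ?e 0 k x = 0" if "x \<notin> {a..a + D}" for x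
    proof -
      from a that have "x \<notin> supp (?e 0 k)" by blast
      then show ?thesis by (simp add: zero_off_supp)
    qed
    moreover have "continuous_on UNIV (\<lambda>x. f x * ?e 0 k x)" by (intro continuous_intros fc ec)
    ultimately have "\<bar>L2_inner f (?e 0 k)\<bar> \<le> F * W * D"
      unfolding L2_inner_def using D(1) by (intro compactly_supported_integral(2)) auto
    with nonneg True show ?thesis by simp
  next
    case False
    define d where "d = D * 2 powr (- real j)"
    have d: "0 < d" using D by (simp add: d_def)
    obtain a where a: "supp (?e j k) \<subseteq> {a..a + d}" using D(2) d_def by blast
    have "has_bochner_integral lborel (\<lambda>x. x ^ n * ?e j k x) 0" if "n < v" for n
      using vm False that by (simp add: vanishing_moments_def by_level_def)
    from wavelet_coefficient_bound[OF fc M(2,1) ec W(2) a d this]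
    have "\<bar>L2_inner f (?e j k)\<bar> \<le> M * d powr r * (W * 2 powr (real j * (1/2))) * d" .
    also have "d powr r = D powr r * 2 powr (- (real j * r))"
      using D by (simp add: d_def powr_mult powr_powr)
    also have "M * (D powr r * 2 powr (- (real j * r))) * (W * 2 powr (real j * (1/2))) * d
        = (M * D powr r * W * D) * (2 powr (- (real j * r)) * 2 powr (real j * (1/2)) * 2 powr (- real j))"
      by (simp only: d_def mult_ac)
    also have "2 powr (- (real j * r)) * 2 powr (real j * (1/2)) * 2 powr (- real j)
        = (2::real) powr (- (real j * (r + 1/2)))"
      unfolding powr_add[symmetric] by (rule arg_cong[where f = "\<lambda>t. 2 powr t"]) (simp add: algebra_simps)
    also have "(M * D powr r * W * D) * 2 powr (- (real j * (r + 1/2))) \<le> ?B * 2 powr (- (real j * (r + 1/2)))"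
      using nonneg by (intro mult_right_mono) auto
    finally show ?thesis .
  qed
  moreover have "by_level (\<lambda>k. L2_inner f (\<phi> k)) (\<lambda>j k. L2_inner f (\<psi> j k)) j k = L2_inner f (?e j k)" for j k
    by (simp add: by_level_def)
  ultimately show ?thesis
    unfolding admissible_coeffs_iff using nonneg by (intro exI[of _ ?B]) auto
qed

lemma besov_analysis_series:
  assumes f: "f \<in> besov r" and r: "0 < r"
    and frame: "parseval_frame (wavelet_family \<phi> \<psi>) wavelet_index"
    and cs: "compactly_supported_system \<phi> \<psi>"
  shows "wavelet_series_sum \<phi> \<psi> (\<lambda>k. L2_inner f (\<phi> k)) (\<lambda>j k. L2_inner f (\<psi> j k)) f"
proof -
  obtain D where D: "0 < D" "\<And>j k. \<exists>a. supp (by_level \<phi> \<psi> j k) \<subseteq> {a..a + D * 2 powr (- real j)}"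
    using by_level_supp_interval[OF cs] by blast
  have "\<exists>a. supp (wavelet_family \<phi> \<psi> i) \<subseteq> {a..a + D}" if i: "i \<in> wavelet_index" for i
  proof -
    obtain j k where jk: "level_index i = (j, k)" by fastforce
    obtain a where "supp (by_level \<phi> \<psi> j k) \<subseteq> {a..a + D * 2 powr (- real j)}" using D(2) by blast
    moreover have "D * 2 powr (- real j) \<le> D * 1"
      using D(1) powr_mono[of "- real j" 0 2] by (intro mult_left_mono) auto
    ultimately have "supp (by_level \<phi> \<psi> j k) \<subseteq> {a..a + D}" by fastforce
    then show ?thesis unfolding wavelet_family_by_level[OF i] jk by auto
  qed
  from parseval_frame_L2loc[OF frame this besov_continuous[OF f r]]
  have "L2loc_has_sum (\<lambda>i x. L2_inner f (wavelet_family \<phi> \<psi> i) * wavelet_family \<phi> \<psi> i x) wavelet_index f" .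
  moreover have "wavelet_family (\<lambda>k. L2_inner f (\<phi> k)) (\<lambda>j k. L2_inner f (\<psi> j k))
      = (\<lambda>i. L2_inner f (wavelet_family \<phi> \<psi> i))"
    by (auto simp: wavelet_family_def fun_eq_iff split: sum.split)
  ultimately show ?thesis by (simp add: wavelet_series_sum_def)
qed

theorem theorem1p2:
  fixes s r :: real and v :: nat
    and \<phi> :: "int \<Rightarrow> real \<Rightarrow> real" and \<psi> :: "nat \<Rightarrow> int \<Rightarrow> real \<Rightarrow> real"
  assumes "s > 0" and "v \<ge> 1"
    and "parseval_frame (wavelet_family \<phi> \<psi>) wavelet_index"
    and "compactly_supported_system \<phi> \<psi>"
    and "locally_finite_system \<phi> \<psi>"
    and "vanishing_moments v \<psi>"
    and "smooth_system s \<phi> \<psi>"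
    and "0 < r" and "r < min s (real v)"
  shows "(\<forall>a b. admissible_coeffs r a b \<longrightarrow> (\<exists>f. wavelet_series_sum \<phi> \<psi> a b f)) \<and>
         ae_class ` besov r =
           ae_class ` {f. \<exists>a b. admissible_coeffs r a b \<and> wavelet_series_sum \<phi> \<psi> a b f}"
proof -
  have rs: "r < s" and rv: "r < real v" using assms(9) by auto
  note synthesis = admissible_coeffs_synthesis[OF assms(7,5,8) rs]
  let ?W = "{f. \<exists>a b. admissible_coeffs r a b \<and> wavelet_series_sum \<phi> \<psi> a b f}"
  have sub: "besov r \<subseteq> ?W"
    using besov_analysis_coeffs[OF _ assms(8) rv assms(1,4,6,7)]
      besov_analysis_series[OF _ assms(8,3,4)] by blast
  have "ae_class g \<in> ae_class ` besov r" if "g \<in> ?W" for g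
  proof -
    obtain a b where ab: "admissible_coeffs r a b" "wavelet_series_sum \<phi> \<psi> a b g" using \<open>g \<in> ?W\<close> by blast
    obtain f where f: "f \<in> besov r" "wavelet_series_sum \<phi> \<psi> a b f" using synthesis[OF ab(1)] by blast
    have "AE x in lborel. g x = f x"
      using ab(2) f(2) unfolding wavelet_series_sum_def by (rule L2loc_has_sum_unique)
    then have "ae_class g = ae_class f" by (rule ae_class_cong)
    with f(1) show ?thesis by simp
  qed
  then have "ae_class ` ?W \<subseteq> ae_class ` besov r" by (rule image_subsetI)
  with image_mono[OF sub] have "ae_class ` besov r = ae_class ` ?W" by (intro equalityI)
  with synthesis show ?thesis by blast
qed

end
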